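(* Let $\mathbb{H}$ be a real separable Hilbert space with unit sphere $\mathbb{S}$, let $x\in\mathbb{H}$, let $u\in(0,1)$, and let $X\sim P_X$ be a random element of $\mathbb{H}$ with $\sup_{y\in\mathbb{H}}P_X(\{y\})<1/2$, where $P_X$ has either finite or contiguous support. Let $V\sim\nu$ be a random element of $\mathbb{S}$, independent of $X$, such that the support of $\nu$ is the whole set $\mathbb{S}$, and $\nu(H\cap\mathbb{S})=0$ for every hyperplane $H\subset\mathbb{H}$ passing through the origin. Assume that $\beta(u)=q_u[\mathsf{MAD}[\langle X,V\rangle]]$ is uniquely defined, i.e. the distribution function of $\mathsf{MAD}[\langle X,V\rangle]$ is strictly increasing at $\beta(u)$. Additionally, assume that the maximal outlyingness function $\Gamma_x(\cdot)$ is continuous at $\beta(u)$. Then the approximated random regularized projection depth $D^{(M)}_{(u)}(x;P_X)$, based on $L$ random directions for approximating $\beta(u)$ and $M$ random directions for approximating the infimum in the depth, converges almost surely to the theoretical regularized projection depth as the number of directions increases, that is, $$\lim_{M,L\to\infty}D^{(M)}_{(u)}(x;P_X)=D_{(u)}(x;P_X)\quad\text{almost surely.}$$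
   Context: $\mathbb{H}$ has inner product $\langle\cdot,\cdot\rangle$ and induced norm $\|\cdot\|$; $\mathbb{S}=\{v\in\mathbb{H}:\|v\|=1\}$. A hyperplane is a set $\{y\in\mathbb{H}:\langle y,v\rangle=c\}$ with $v\in\mathbb{S}$, $c\in\mathbb{R}$. The support of a probability measure is the smallest closed set of measure one. $P_X$ has finite support if its support is a finite set; it has contiguous support if for each $v\in\mathbb{S}$ the support of the real random variable $\langle X,v\rangle$ is connected. For a real random variable $U$, $\mathsf{med}[U]$ is the midpoint of the set of all $m\in\mathbb{R}$ with $\min\{\mathbb{P}(U\le m),\mathbb{P}(U\ge m)\}\ge1/2$, and $\mathsf{MAD}[U]=\mathsf{med}[|U-\mathsf{med}[U]|]$. For a non-negative random variable $Z$ with distribution function $F$, $q_u[Z]=\inf\{z\ge0:F(z)\ge u\}$. "$F$ strictly increasing at $\beta$" means $F(s)<F(\beta)<F(t)$ for all $s<\beta<t$. $\mathsf{MAD}[\langle X,V\rangle]$ is viewed as the random variable $\omega\mapsto\mathsf{MAD}[\langle X,V(\omega)\rangle]$, random through $V$ only. For $v\in\mathbb{S}$, $y\in\mathbb{H}$, $$O_v(y;P_X)=\frac{|\langle y,v\rangle-\mathsf{med}[\langle X,v\rangle]|}{\mathsf{MAD}[\langle X,v\rangle]}.$$ For $t\ge0$ let $\mathcal{V}_t=\{v\in\mathbb{S}:\mathsf{MAD}[\langle X,v\rangle]\ge t\}$ and $\Gamma_y(t)=\sup_{v\in\mathcal{V}_t}O_v(y;P_X)$, $t\in[0,\infty)$.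 The (theoretical) regularized projection depth is $D_{(u)}(y;P_X)=\inf_{v\in\mathcal{V}_{\beta(u)}}(1+O_v(y;P_X))^{-1}$. Random approximation: for $L\in\mathbb{N}$, sample $L$ independent directions $u_1,\dots,u_L\in\mathbb{S}$ from $\nu$, and let $\beta^{(L)}(u)$ be the sample $u$-quantile of $\{\mathsf{MAD}[\langle X,u_i\rangle]\}_{i=1}^L$. Next, for $M\in\mathbb{N}$, sample $M$ independent directions $v_1,\dots,v_M\in\mathbb{S}$ from the distribution $\nu$ conditioned on the set $\mathcal{V}^{(L)}_{(u)}=\mathcal{V}_{\beta^{(L)}(u)}$. The approximated random depth (which depends on both $M$ and $L$, although $L$ is suppressed in the notation) is $$D^{(M)}_{(u)}(y;P_X)=\min_{m=1,\dots,M}\big(1+O_{v_m}(y;P_X)\big)^{-1}.$$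
   Formalization: The joint limit in M and L is false if the v-samples for different L are drawn independently; it is proved for samples drawn by rejection from one common sequence, and for any coupling the limits along L = l(M) → ∞ and the iterated limit (M, then L) are proved. *)

theory Defs
  imports "HOL-Probability.Probability"
begin

definition hyperplane :: "'h::real_inner set \<Rightarrow> bool" where
  "hyperplane H \<longleftrightarrow> (\<exists>v\<in>sphere 0 1. \<exists>c::real. H = {y. y \<bullet> v = c})"

(* In a second countable space this intersection itself has measure one,
   so it is the smallest closed set of measure one. *)
definition msupport :: "'s::topological_space measure \<Rightarrow> 's set" where
  "msupport N = \<Inter>{C. closed C \<and> emeasure N C = 1}"

definition finite_support :: "'h::real_inner measure \<Rightarrow> bool" where
  "finite_support P \<longleftrightarrow> finite (msupport P)"

definition contiguous_support :: "'h::real_inner measure \<Rightarrow> bool" where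
  "contiguous_support P \<longleftrightarrow>
     (\<forall>v\<in>sphere 0 1. connected (msupport (distr P borel (\<lambda>x. x \<bullet> v))))"

definition medians :: "'s measure \<Rightarrow> ('s \<Rightarrow> real) \<Rightarrow> real set" where
  "medians N U = {m. min (measure N {\<omega>\<in>space N. U \<omega> \<le> m}) (measure N {\<omega>\<in>space N. U \<omega> \<ge> m}) \<ge> 1/2}"

(* For a random variable the set of medians is a nonempty compact interval. *)
definition med :: "'s measure \<Rightarrow> ('s \<Rightarrow> real) \<Rightarrow> real" where
  "med N U = midpoint (Inf (medians N U)) (Sup (medians N U))"

definition MAD :: "'s measure \<Rightarrow> ('s \<Rightarrow> real) \<Rightarrow> real" where
  "MAD N U = med N (\<lambda>\<omega>. \<bar>U \<omega> - med N U\<bar>)"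

(* Argument F is a distribution function. *)
definition quantile :: "(real \<Rightarrow> real) \<Rightarrow> real \<Rightarrow> real" where
  "quantile F u = Inf {z. 0 \<le> z \<and> u \<le> F z}"

definition strictly_increasing_at :: "(real \<Rightarrow> real) \<Rightarrow> real \<Rightarrow> bool" where
  "strictly_increasing_at F b \<longleftrightarrow> (\<forall>s t. s < b \<and> b < t \<longrightarrow> F s < F b \<and> F b < F t)"

(* The laws of projections depend on X only through its distribution P,
   so X is represented by the identity on the probability space P. *)
definition proj_med :: "'h::real_inner measure \<Rightarrow> 'h \<Rightarrow> real" where
  "proj_med P v = med P (\<lambda>x. x \<bullet> v)"

definition proj_MAD :: "'h::real_inner measure \<Rightarrow> 'h \<Rightarrow> real" where
  "proj_MAD P v = MAD P (\<lambda>x. x \<bullet> v)"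

(* Extended values: a / 0 = \<infinity> for a > 0, 0 / 0 = 0, and suprema may be infinite. *)
definition outlyingness :: "'h::real_inner measure \<Rightarrow> 'h \<Rightarrow> 'h \<Rightarrow> ennreal" where
  "outlyingness P v y = ennreal \<bar>y \<bullet> v - proj_med P v\<bar> / ennreal (proj_MAD P v)"

definition directions :: "'h::real_inner measure \<Rightarrow> real \<Rightarrow> 'h set" where
  "directions P t = {v \<in> sphere 0 1. proj_MAD P v \<ge> t}"

definition max_outlyingness :: "'h::real_inner measure \<Rightarrow> 'h \<Rightarrow> real \<Rightarrow> ennreal" where
  "max_outlyingness P y t = (SUP v\<in>directions P t. outlyingness P v y)"

definition reg_depth :: "'h::real_inner measure \<Rightarrow> real \<Rightarrow> 'h \<Rightarrow> ennreal" where
  "reg_depth P b y = (INF v\<in>directions P b. inverse (1 + outlyingness P v y))"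

(* The u-quantile of the empirical distribution of the MADs along d 0, ..., d (L - 1). *)
definition sample_quantile :: "'h::real_inner measure \<Rightarrow> real \<Rightarrow> nat \<Rightarrow> (nat \<Rightarrow> 'h) \<Rightarrow> real" where
  "sample_quantile P u L d =
     quantile (\<lambda>z. real (card {i. i < L \<and> proj_MAD P (d i) \<le> z}) / real L) u"

definition approx_depth :: "'h::real_inner measure \<Rightarrow> nat \<Rightarrow> (nat \<Rightarrow> 'h) \<Rightarrow> 'h \<Rightarrow> ennreal" where
  "approx_depth P M v y = Min ((\<lambda>m. inverse (1 + outlyingness P (v m) y)) ` {..<M})"

(* d 0, d 1, ... are independent with law nu. For every L \<ge> 1, conditionally on
   d 0, ..., d (L - 1), the directions v L 0, v L 1, ... are independent, each with the law nu
   conditioned on the directions whose MAD is at least the sample quantile.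
   The joint law of v L and v L' for L \<noteq> L' is left open. *)
definition direction_sampling ::
  "'w measure \<Rightarrow> 'h::{real_inner, second_countable_topology} measure \<Rightarrow> 'h measure \<Rightarrow> real \<Rightarrow>
   (nat \<Rightarrow> 'w \<Rightarrow> 'h) \<Rightarrow> (nat \<Rightarrow> nat \<Rightarrow> 'w \<Rightarrow> 'h) \<Rightarrow> bool" where
  "direction_sampling Q \<nu> P u d v \<longleftrightarrow>
     prob_space Q \<and>
     prob_space.indep_vars Q (\<lambda>_. borel) d UNIV \<and>
     (\<forall>i. distr Q borel (d i) = \<nu>) \<and>
     (\<forall>L m. v L m \<in> borel_measurable Q) \<and>
     (\<forall>L\<ge>1. \<forall>M B. (\<forall>j<M. B j \<in> sets borel) \<longrightarrow>
       (AE \<omega> in Q.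
          real_cond_exp Q
            (vimage_algebra (space Q) (\<lambda>\<omega>. \<lambda>i\<in>{..<L}. d i \<omega>) (PiM {..<L} (\<lambda>_. borel)))
            (indicator {\<omega> \<in> space Q. \<forall>j<M. v L j \<omega> \<in> B j}) \<omega>
          = (\<Prod>j<M. measure
               (uniform_measure \<nu> (directions P (sample_quantile P u L (\<lambda>i. d i \<omega>)))) (B j))))"

(* The samples for the different values of L are drawn by rejection from one common sequence w:
   v L 0, v L 1, ... are the successive members of w lying in the L-th set of directions. *)
definition common_proposals ::
  "'w measure \<Rightarrow> 'h::real_inner measure \<Rightarrow> real \<Rightarrow>
   (nat \<Rightarrow> 'w \<Rightarrow> 'h) \<Rightarrow> (nat \<Rightarrow> nat \<Rightarrow> 'w \<Rightarrow> 'h) \<Rightarrow> (nat \<Rightarrow> 'w \<Rightarrow> 'h) \<Rightarrow> bool" where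
  "common_proposals Q P u d v w \<longleftrightarrow>
     (AE \<omega> in Q. \<forall>L\<ge>1. \<exists>r::nat \<Rightarrow> nat. strict_mono r \<and>
        range r = {k. w k \<omega> \<in> directions P (sample_quantile P u L (\<lambda>i. d i \<omega>))} \<and>
        (\<forall>m. v L m \<omega> = w (r m) \<omega>))"

end

theory Submission
  imports Defs
begin

text \<open>The medians and the MAD of a projection depend continuously on the direction: a
  nondegenerate median interval is impossible for a connected support, and for a finite support it
  varies continuously as a whole. By Fubini and the bound on the atoms, the MAD is positive in
  almost every direction, so \<open>\<beta> > 0\<close> and the outlyingness is continuous on the relevant directions.
  Hoeffding's inequality and the Borel--Cantelli lemma trap the sample quantile between any
  \<open>s < \<beta> < b\<close> eventually. Then the sampled directions have MAD at least \<open>s\<close>, which bounds the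
  approximated depth from below by the depth at level \<open>s\<close>. Conversely, the nearly optimal directions
  for a level above \<open>\<beta>\<close> contain a relatively open set of positive measure, which \<open>M\<close> draws miss with
  probability exponentially small in \<open>M\<close>, uniformly in \<open>L\<close>. Continuity of the maximal outlyingness
  closes the gap. For common proposals, one nearly optimal proposal serves all large \<open>L\<close> at once.\<close>

section \<open>Median intervals: end points and stability under pointwise convergence\<close>

context prob_space begin

text \<open>The least point where the distribution function reaches 1/2 is itself a median: right
  continuity gives the lower-tail condition, the left limit gives the upper-tail one. Every later
  claim about medians is thereby reduced to probabilities of half-lines.\<close>

lemma Inf_medians_le_iff:
  assumes [measurable]: "U \<in> borel_measurable M"
  shows "Inf (medians M U) \<le> c \<longleftrightarrow> 1/2 \<le> prob {\<omega>\<in>space M. U \<omega> \<le> c}"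
proof -
  interpret D: real_distribution "distr M borel U" by simp
  let ?F = "cdf (distr M borel U)"
  have F: "?F c = prob {\<omega>\<in>space M. U \<omega> \<le> c}" for c
    by (simp add: cdf_def measure_distr vimage_def Int_def conj_commute)
  define S where "S = {c. 1/2 \<le> ?F c}"
  have "eventually (\<lambda>c. 1/2 < ?F c) at_top"
    using D.cdf_lim_at_top_prob by (rule order_tendstoD) simp
  then have "S \<noteq> {}"
    by (auto simp: S_def eventually_at_top_linorder intro: less_imp_le)
  have "eventually (\<lambda>c. ?F c < 1/2) at_bot"
    using D.cdf_lim_at_bot by (rule order_tendstoD) simp
  then obtain l where l: "\<And>c. c \<le> l \<Longrightarrow> ?F c < 1/2"
    by (auto simp: eventually_at_bot_linorder)
  then have bdd: "bdd_below S"
    by (intro bdd_belowI[of _ l]) (force simp: S_def not_less[symmetric])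
  define a where "a = Inf S"
  have "1/2 \<le> ?F c" if "a < c" for c
  proof -
    from that \<open>S \<noteq> {}\<close> obtain s where "s \<in> S" "s < c"
      unfolding a_def by (meson cInf_lessD)
    then show ?thesis using D.cdf_nondecreasing[of s c] by (simp add: S_def)
  qed
  then have Fa: "1/2 \<le> ?F a"
    by (intro tendsto_lowerbound[OF D.cdf_is_right_cont[of a, unfolded continuous_within]])
       (auto simp: eventually_at_right_field intro!: exI[of _ "a + 1"])
  have "?F c \<le> 1/2" if "c < a" for c
    using that cInf_lower[OF _ bdd, of c] by (fastforce simp: a_def S_def)
  then have "measure (distr M borel U) {..<a} \<le> 1/2"
    by (intro tendsto_upperbound[OF D.cdf_at_left[of a]])
       (auto simp: eventually_at_left_field intro!: exI[of _ "a - 1"])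
  then have "prob {\<omega>\<in>space M. U \<omega> < a} \<le> 1/2"
    by (simp add: measure_distr vimage_def Int_def conj_commute)
  moreover have "prob {\<omega>\<in>space M. U \<omega> \<ge> a} = 1 - prob {\<omega>\<in>space M. U \<omega> < a}"
    by (subst prob_compl[symmetric]) (auto intro!: arg_cong[where f=prob])
  ultimately have "a \<in> medians M U"
    using Fa by (simp add: medians_def F)
  moreover have "a \<le> m" if "m \<in> medians M U" for m
    using that unfolding a_def by (intro cInf_lower[OF _ bdd]) (simp add: S_def medians_def F)
  ultimately have "Inf (medians M U) = a"
    by (rule cInf_eq_minimum)
  moreover have "a \<le> c \<longleftrightarrow> 1/2 \<le> ?F c"
    using D.cdf_nondecreasing[of a c] Fa cInf_lower[OF _ bdd, of c] by (auto simp: a_def S_def)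
  ultimately show ?thesis by (simp add: F)
qed

text \<open>Reflection, so that only the lower end of the median interval has to be
  analysed.\<close>

lemma Sup_medians_eq: "Sup (medians M U) = - Inf (medians M (\<lambda>\<omega>. - U \<omega>))"
proof -
  have "medians M (\<lambda>\<omega>. - U \<omega>) = uminus ` medians M U"
  proof (intro set_eqI iffI)
    fix m assume "m \<in> medians M (\<lambda>\<omega>. - U \<omega>)"
    then have "- m \<in> medians M U"
      by (simp add: medians_def minus_le_iff le_minus_iff)
    then show "m \<in> uminus ` medians M U"
      by (metis image_eqI minus_minus)
  next
    fix m assume "m \<in> uminus ` medians M U"
    then show "m \<in> medians M (\<lambda>\<omega>. - U \<omega>)"
      by (auto simp: medians_def)
  qed
  then show ?thesis by (simp add: Inf_real_def image_image)
qed

lemma le_Sup_medians_iff: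
  assumes [measurable]: "U \<in> borel_measurable M"
  shows "c \<le> Sup (medians M U) \<longleftrightarrow> 1/2 \<le> prob {\<omega>\<in>space M. c \<le> U \<omega>}"
  using Inf_medians_le_iff[of "\<lambda>\<omega>. - U \<omega>" "- c"] by (simp add: Sup_medians_eq le_minus_iff)

lemma Inf_le_Sup_medians:
  assumes [measurable]: "U \<in> borel_measurable M"
  shows "Inf (medians M U) \<le> Sup (medians M U)"
proof (rule dense_le)
  fix c assume "c < Inf (medians M U)"
  then have "prob {\<omega>\<in>space M. U \<omega> \<le> c} < 1/2"
    using Inf_medians_le_iff[of U c] by simp
  moreover have "prob {\<omega>\<in>space M. U \<omega> > c} = 1 - prob {\<omega>\<in>space M. U \<omega> \<le> c}"
    by (subst prob_compl[symmetric]) (auto intro!: arg_cong[where f=prob])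
  moreover have "prob {\<omega>\<in>space M. U \<omega> > c} \<le> prob {\<omega>\<in>space M. c \<le> U \<omega>}"
    by (intro finite_measure_mono) auto
  ultimately show "c \<le> Sup (medians M U)"
    by (subst le_Sup_medians_iff) auto
qed

text \<open>Lower semicontinuity of the smallest median. The events that some later
  \<open>Y n\<close> is at most \<open>c\<close> decrease to a subset of \<open>U \<le> c\<close>,
  which has mass below 1/2; continuity from above transfers this bound to large
  \<open>n\<close>.\<close>

lemma eventually_less_Inf_medians:
  fixes Y :: "nat \<Rightarrow> 'a \<Rightarrow> real"
  assumes [measurable]: "U \<in> borel_measurable M" "\<And>n. Y n \<in> borel_measurable M"
    and lim: "\<And>\<omega>. \<omega> \<in> space M \<Longrightarrow> (\<lambda>n. Y n \<omega>) \<longlonglongrightarrow> U \<omega>"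
    and c: "c < Inf (medians M U)"
  shows "eventually (\<lambda>n. c < Inf (medians M (Y n))) sequentially"
proof -
  define A where "A k = {\<omega>\<in>space M. \<exists>n\<ge>k. Y n \<omega> \<le> c}" for k
  have [measurable]: "A k \<in> sets M" for k by (simp add: A_def)
  have "(\<lambda>k. prob (A k)) \<longlonglongrightarrow> prob (\<Inter>k. A k)"
    by (intro finite_Lim_measure_decseq) (auto simp: A_def decseq_def intro: le_trans)
  moreover have "prob (\<Inter>k. A k) \<le> prob {\<omega>\<in>space M. U \<omega> \<le> c}"
  proof (intro finite_measure_mono subsetI)
    fix \<omega> assume \<omega>: "\<omega> \<in> (\<Inter>k. A k)"
    show "\<omega> \<in> {\<omega>\<in>space M. U \<omega> \<le> c}"
    proof (rule ccontr)
      assume "\<omega> \<notin> {\<omega>\<in>space M. U \<omega> \<le> c}"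
      with \<omega> have "\<omega> \<in> space M" "c < U \<omega>" by (auto simp: A_def)
      then have "eventually (\<lambda>n. c < Y n \<omega>) sequentially"
        by (intro order_tendstoD(1)[OF lim])
      then show False using \<omega> by (force simp: A_def eventually_sequentially)
    qed
  qed simp
  moreover have "prob {\<omega>\<in>space M. U \<omega> \<le> c} < 1/2"
    using Inf_medians_le_iff[of U c] c by simp
  ultimately have "eventually (\<lambda>k. prob (A k) < 1/2) sequentially"
    by (intro order_tendstoD(2)[where y = "prob (\<Inter>k. A k)"]) linarith+
  then show ?thesis
  proof eventually_elim
    fix n assume "prob (A n) < 1/2"
    moreover have "prob {\<omega>\<in>space M. Y n \<omega> \<le> c} \<le> prob (A n)"
      by (intro finite_measure_mono) (auto simp: A_def)
    ultimately show "c < Inf (medians M (Y n))"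
      using Inf_medians_le_iff[of "Y n" c] by simp
  qed
qed

text \<open>Pointwise convergence does not control both ends of a nondegenerate median interval,
  but for a finite support convergence is uniform.\<close>

lemma tendsto_Inf_medians:
  fixes Y :: "nat \<Rightarrow> 'a \<Rightarrow> real"
  assumes [measurable]: "U \<in> borel_measurable M" "\<And>n. Y n \<in> borel_measurable M"
    and lim: "\<And>\<omega>. \<omega> \<in> space M \<Longrightarrow> (\<lambda>n. Y n \<omega>) \<longlonglongrightarrow> U \<omega>"
    and fin: "Inf (medians M U) < Sup (medians M U) \<Longrightarrow> \<exists>S. finite S \<and> (AE \<omega> in M. \<omega> \<in> S)"
  shows "(\<lambda>n. Inf (medians M (Y n))) \<longlonglongrightarrow> Inf (medians M U)"
proof (rule order_tendstoI)
  fix c assume "c < Inf (medians M U)"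
  then show "eventually (\<lambda>n. c < Inf (medians M (Y n))) sequentially"
    by (intro eventually_less_Inf_medians[OF _ _ lim]) auto
next
  fix c assume c: "Inf (medians M U) < c"
  show "eventually (\<lambda>n. Inf (medians M (Y n)) < c) sequentially"
  proof (cases "Inf (medians M U) < Sup (medians M U)")
    case False
    \<comment> \<open>With a unique median, lower semicontinuity for the negated variables bounds
      the largest median of \<open>Y n\<close>, which dominates the smallest.\<close>
    then have "Sup (medians M U) < c" using c by simp
    then have "eventually (\<lambda>n. - c < Inf (medians M (\<lambda>\<omega>. - Y n \<omega>))) sequentially"
      by (intro eventually_less_Inf_medians[of "\<lambda>\<omega>. - U \<omega>"])
         (auto intro: tendsto_minus lim simp: Sup_medians_eq)
    then show ?thesis
    proof eventually_elim
      fix n assume "- c < Inf (medians M (\<lambda>\<omega>. - Y n \<omega>))"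
      then have "Sup (medians M (Y n)) < c" by (simp add: Sup_medians_eq)
      then show "Inf (medians M (Y n)) < c"
        using Inf_le_Sup_medians[of "Y n"] by simp
    qed
  next
    case True
    then obtain S where S: "finite S" "AE \<omega> in M. \<omega> \<in> S" using fin by blast
    \<comment> \<open>The finitely many points of \<open>S\<close> with \<open>U\<close> at most its
      smallest median carry mass at least 1/2, and eventually \<open>Y n\<close> is below
      \<open>b\<close> on all of them at once. The intermediate \<open>b\<close> makes the final
      inequality strict.\<close>
    obtain b where b: "Inf (medians M U) < b" "b < c" using c dense by blast
    have "eventually (\<lambda>n. \<forall>\<omega>\<in>S \<inter> {\<omega>\<in>space M. U \<omega> \<le> Inf (medians M U)}. Y n \<omega> < b) sequentially"
      using S(1) b(1) by (intro eventually_ball_finite ballI order_tendstoD[OF lim]) auto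
    then show ?thesis
    proof eventually_elim
      fix n assume n: "\<forall>\<omega>\<in>S \<inter> {\<omega>\<in>space M. U \<omega> \<le> Inf (medians M U)}. Y n \<omega> < b"
      have "prob {\<omega>\<in>space M. U \<omega> \<le> Inf (medians M U)} \<le> prob {\<omega>\<in>space M. Y n \<omega> \<le> b}"
        using S(2)
      proof (intro finite_measure_mono_AE, elim AE_mp, intro AE_I2 impI)
        fix \<omega> assume "\<omega> \<in> space M" "\<omega> \<in> S" "\<omega> \<in> {\<omega>\<in>space M. U \<omega> \<le> Inf (medians M U)}"
        then show "\<omega> \<in> {\<omega>\<in>space M. Y n \<omega> \<le> b}" using n by force
      qed simp
      moreover have "1/2 \<le> prob {\<omega>\<in>space M. U \<omega> \<le> Inf (medians M U)}"
        using Inf_medians_le_iff[of U "Inf (medians M U)"] by simp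
      ultimately have "Inf (medians M (Y n)) \<le> b"
        by (subst Inf_medians_le_iff) auto
      then show "Inf (medians M (Y n)) < c" using b by simp
    qed
  qed
qed

lemma tendsto_med:
  fixes Y :: "nat \<Rightarrow> 'a \<Rightarrow> real"
  assumes [measurable]: "U \<in> borel_measurable M" "\<And>n. Y n \<in> borel_measurable M"
    and lim: "\<And>\<omega>. \<omega> \<in> space M \<Longrightarrow> (\<lambda>n. Y n \<omega>) \<longlonglongrightarrow> U \<omega>"
    and fin: "Inf (medians M U) < Sup (medians M U) \<Longrightarrow> \<exists>S. finite S \<and> (AE \<omega> in M. \<omega> \<in> S)"
  shows "(\<lambda>n. med M (Y n)) \<longlonglongrightarrow> med M U"
proof -
  have "(\<lambda>n. Inf (medians M (\<lambda>\<omega>. - Y n \<omega>))) \<longlonglongrightarrow> Inf (medians M (\<lambda>\<omega>. - U \<omega>))"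
    using fin Sup_medians_eq[of U] Sup_medians_eq[of "\<lambda>\<omega>. - U \<omega>"]
    by (intro tendsto_Inf_medians) (auto intro: tendsto_minus lim)
  then show ?thesis
    unfolding med_def midpoint_def Sup_medians_eq
    using tendsto_Inf_medians[OF assms] by (intro tendsto_intros) auto
qed

end

section \<open>Supports of probability measures\<close>

lemma emeasure_msupport:
  fixes N :: "'s::second_countable_topology measure"
  assumes "prob_space N" and sets: "sets N = sets borel"
  shows "emeasure N (msupport N) = 1"
proof -
  interpret prob_space N by fact
  obtain \<B> :: "'s set set" where \<B>: "countable \<B>" "\<And>C. C \<in> \<B> \<Longrightarrow> open C"
    "\<And>S. open S \<Longrightarrow> \<exists>U. U \<subseteq> \<B> \<and> S = \<Union>U"
    using univ_second_countable by blast
  have "space N = UNIV" using sets_eq_imp_space_eq[OF sets] by simp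
  have op: "C \<in> sets N" if "open C" for C using that by (simp add: sets)
  \<comment> \<open>The null members of a countable base have a null union, and this union is
    exactly the complement of the support.\<close>
  define \<N> where "\<N> = {C\<in>\<B>. emeasure N C = 0}"
  have "\<Union>\<N> \<in> null_sets N"
  proof -
    have "(\<Union>C\<in>\<N>. C) \<in> null_sets N"
    proof (rule null_sets_UN')
      show "countable \<N>" by (rule countable_subset[OF _ \<B>(1)]) (simp add: \<N>_def)
      show "C \<in> null_sets N" if "C \<in> \<N>" for C
        using that \<B>(2) op by (intro null_setsI) (simp_all add: \<N>_def)
    qed
    then show ?thesis by simp
  qed
  moreover have "- msupport N = \<Union>\<N>"
  proof (intro equalityI subsetI)
    fix x assume "x \<in> - msupport N"
    then obtain C where C: "closed C" "emeasure N C = 1" "x \<notin> C"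
      by (auto simp: msupport_def)
    then obtain U where U: "U \<subseteq> \<B>" "- C = \<Union>U" using \<B>(3)[of "- C"] by auto
    have CN: "C \<in> sets N" using C by (simp add: sets)
    then have "emeasure N (- C) = 0"
      using C(2) \<open>space N = UNIV\<close> emeasure_compl[of C N] emeasure_space_1
      by (simp add: Compl_eq_Diff_UNIV)
    from U C(3) obtain B where B: "B \<in> U" "x \<in> B" by auto
    have "B \<subseteq> - C" using B U by auto
    then have "emeasure N B \<le> emeasure N (- C)" using C(1) sets
      by (intro emeasure_mono) auto
    then show "x \<in> \<Union>\<N>"
      using B U \<open>emeasure N (- C) = 0\<close> by (auto simp: \<N>_def)
  next
    fix x assume "x \<in> \<Union>\<N>"
    then obtain B where B: "B \<in> \<B>" "emeasure N B = 0" "x \<in> B" by (auto simp: \<N>_def)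
    then have "emeasure N (- B) = 1"
      using \<open>space N = UNIV\<close> emeasure_compl[of B N] op[OF \<B>(2)[OF B(1)]] emeasure_space_1
      by (simp add: Compl_eq_Diff_UNIV)
    with B \<B>(2) show "x \<in> - msupport N"
      by (auto simp: msupport_def intro!: exI[of _ "- B"])
  qed
  ultimately have null: "- msupport N \<in> null_sets N" by simp
  have "emeasure N (UNIV - - msupport N) = emeasure N UNIV"
    by (rule emeasure_Diff_null_set[OF null]) (use \<open>space N = UNIV\<close> sets.top[of N] in auto)
  then show ?thesis using emeasure_space_1 \<open>space N = UNIV\<close> by (simp add: Compl_eq_Diff_UNIV[symmetric])
qed

lemma AE_in_msupport:
  fixes N :: "'s::second_countable_topology measure"
  assumes "prob_space N" and sets: "sets N = sets borel"
  shows "AE x in N. x \<in> msupport N"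
proof -
  interpret prob_space N by fact
  have "msupport N \<in> sets N"
    unfolding sets msupport_def by (intro borel_closed closed_Inter) auto
  then show ?thesis using emeasure_msupport[OF assms]
    by (intro AE_prob_1) (simp_all add: emeasure_eq_measure)
qed

text \<open>A null open set has a closed complement of measure one, which is one of the sets
  intersected in \<open>msupport\<close>.\<close>

lemma measure_open_pos:
  assumes "prob_space N" "sets N = sets borel" "open W" "W \<inter> msupport N \<noteq> {}"
  shows "0 < measure N W"
proof (rule ccontr)
  interpret prob_space N by fact
  assume "\<not> 0 < measure N W"
  then have "measure N W = 0" using measure_nonneg[of N W] by linarith
  moreover have "W \<in> sets N" using assms by simp
  moreover have "space N = UNIV" using sets_eq_imp_space_eq[OF assms(2)] by simp
  ultimately have "emeasure N (- W) = 1"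
    using prob_compl[of W] by (simp add: Compl_eq_Diff_UNIV emeasure_eq_measure)
  then have "msupport N \<subseteq> - W" using assms(3) by (auto simp: msupport_def)
  with assms(4) show False by auto
qed

text \<open>An open gap of the median interval would disconnect the image of the support.\<close>

lemma (in prob_space) medians_unique_if_connected:
  fixes g :: "real \<Rightarrow> real"
  assumes U[measurable]: "U \<in> borel_measurable M"
    and conn: "connected (msupport (distr M borel U))"
    and g: "continuous_on UNIV g"
  shows "Inf (medians M (\<lambda>\<omega>. g (U \<omega>))) = Sup (medians M (\<lambda>\<omega>. g (U \<omega>)))"
proof (rule ccontr)
  have [measurable]: "g \<in> borel_measurable borel" using g by (rule borel_measurable_continuous_onI)
  interpret D: prob_space "distr M borel U" by (rule prob_space_distr) simp
  let ?W = "\<lambda>\<omega>. g (U \<omega>)"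
  let ?S = "msupport (distr M borel U)"
  assume "\<not> ?thesis"
  then obtain a b where ab: "a = Inf (medians M ?W)" "b = Sup (medians M ?W)" "a < b"
    using Inf_le_Sup_medians[of ?W] by fastforce
  have a: "1/2 \<le> prob {\<omega>\<in>space M. ?W \<omega> \<le> a}"
    using Inf_medians_le_iff[of ?W a] ab by simp
  have b: "1/2 \<le> prob {\<omega>\<in>space M. b \<le> ?W \<omega>}"
    using le_Sup_medians_iff[of ?W b] ab by simp
  have "AE y in distr M borel U. y \<in> ?S"
    by (rule AE_in_msupport) (auto intro: D.prob_space_axioms)
  then have AE_S: "AE \<omega> in M. U \<omega> \<in> ?S"
    by (rule AE_distrD[rotated]) simp
  \<comment> \<open>An event of probability at least 1/2 cannot avoid the support, so each end of
    the median interval is witnessed by a support point.\<close>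
  have ex: "\<exists>s\<in>?S. Q (g s)" if "1/2 \<le> prob {\<omega>\<in>space M. Q (?W \<omega>)}" for Q
  proof (rule ccontr)
    assume "\<not> (\<exists>s\<in>?S. Q (g s))"
    with AE_S have "AE \<omega> in M. \<not> Q (?W \<omega>)" by (auto elim!: eventually_mono)
    then have "prob {\<omega>\<in>space M. Q (?W \<omega>)} \<le> prob {}"
      by (intro finite_measure_mono_AE) auto
    with that show False by simp
  qed
  obtain s t where st: "s \<in> ?S" "g s \<le> a" "t \<in> ?S" "b \<le> g t"
    using ex[OF a] ex[OF b] by blast
  have "connected (g ` ?S)"
    using conn g by (intro connected_continuous_image) (auto intro: continuous_on_subset)
  then have "(a + b) / 2 \<in> g ` ?S"
    by (rule connectedD_interval[where x="g s" and y="g t"]) (use st ab in auto)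
  then obtain r where r: "r \<in> ?S" "g r = (a + b) / 2" by auto
  have "open (g -` {a<..<b})"
    using g by (intro open_vimage) auto
  then have "0 < measure (distr M borel U) (g -` {a<..<b})"
  proof (intro measure_open_pos D.prob_space_axioms)
    have "r \<in> g -` {a<..<b} \<inter> ?S" using r \<open>a < b\<close> by simp
    then show "g -` {a<..<b} \<inter> ?S \<noteq> {}" by blast
  qed auto
  also have "\<dots> = prob {\<omega>\<in>space M. a < ?W \<omega> \<and> ?W \<omega> < b}"
    using \<open>open (g -` {a<..<b})\<close>
    by (subst measure_distr) (auto intro!: arg_cong[where f=prob])
  finally have "0 < prob {\<omega>\<in>space M. a < ?W \<omega> \<and> ?W \<omega> < b}" .
  \<comment> \<open>Two events of mass at least 1/2 and a third of positive mass would partition a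
    space of mass one.\<close>
  moreover have "prob {\<omega>\<in>space M. ?W \<omega> \<le> a} + prob {\<omega>\<in>space M. b \<le> ?W \<omega>} +
      prob {\<omega>\<in>space M. a < ?W \<omega> \<and> ?W \<omega> < b} = prob (space M)"
  proof -
    let ?A = "{\<omega>\<in>space M. ?W \<omega> \<le> a}" and ?B = "{\<omega>\<in>space M. b \<le> ?W \<omega>}"
      and ?C = "{\<omega>\<in>space M. a < ?W \<omega> \<and> ?W \<omega> < b}"
    have "prob (?A \<union> ?B \<union> ?C) = prob (?A \<union> ?B) + prob ?C"
      using \<open>a < b\<close> by (intro finite_measure_Union) auto
    moreover have "prob (?A \<union> ?B) = prob ?A + prob ?B"
      using \<open>a < b\<close> by (intro finite_measure_Union) auto
    moreover have "?A \<union> ?B \<union> ?C = space M" by auto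
    ultimately show ?thesis by metis
  qed
  ultimately show False using a b prob_space by simp
qed

lemma closed_unit_sphere: "closed (sphere 0 1 :: 'a::real_normed_vector set)"
proof -
  have "sphere 0 1 = {x :: 'a. norm x = 1}" by auto
  then show ?thesis by (simp add: closed_Collect_eq continuous_on_norm_id)
qed

section \<open>Continuity of projected medians, MADs and outlyingness in the direction\<close>

locale projection_law = prob_space P
  for P :: "'h::{real_inner, second_countable_topology} measure" +
  assumes sets_P[measurable_cong]: "sets P = sets borel"
    and supp: "finite_support P \<or> contiguous_support P"
begin

lemma borel_measurable_inner_left [measurable]: "(\<lambda>x. x \<bullet> v) \<in> borel_measurable P"
  by measurable

text \<open>Supplies the side condition of \<open>tendsto_med\<close>, with \<open>g\<close> the
  identity for the median and the absolute deviation from the median for the MAD. Under contiguous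
  support a nondegenerate interval is contradictory, so only a finite support has to provide
  \<open>S\<close>.\<close>

lemma proj_medians_unique_or_finite:
  fixes g :: "real \<Rightarrow> real"
  assumes "v \<in> sphere 0 1" "continuous_on UNIV g"
    and "Inf (medians P (\<lambda>x. g (x \<bullet> v))) < Sup (medians P (\<lambda>x. g (x \<bullet> v)))"
  shows "\<exists>S. finite S \<and> (AE x in P. x \<in> S)"
  using supp
proof
  assume "finite_support P"
  then show ?thesis
    using AE_in_msupport[OF prob_space_axioms sets_P] by (auto simp: finite_support_def)
next
  assume "contiguous_support P"
  then have "connected (msupport (distr P borel (\<lambda>x. x \<bullet> v)))"
    using assms(1) by (simp add: contiguous_support_def)
  then show ?thesis
    using medians_unique_if_connected[of "\<lambda>x. x \<bullet> v" g] assms by simp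
qed

lemma continuous_on_proj_med: "continuous_on (sphere 0 1) (proj_med P)"
  unfolding continuous_on_sequentially comp_def
proof (intro allI ballI impI, elim conjE)
  fix w and v :: 'h assume w: "v \<in> sphere 0 1" "w \<longlonglongrightarrow> v"
  show "(\<lambda>n. proj_med P (w n)) \<longlonglongrightarrow> proj_med P v"
    unfolding proj_med_def
    using proj_medians_unique_or_finite[OF w(1), of "\<lambda>t. t"]
    by (intro tendsto_med) (auto intro!: tendsto_intros w(2))
qed

text \<open>Since the centring medians converge, the absolute deviations converge pointwise, and
  stability of medians applies a second time.\<close>

lemma continuous_on_proj_MAD: "continuous_on (sphere 0 1) (proj_MAD P)"
  unfolding continuous_on_sequentially comp_def
proof (intro allI ballI impI, elim conjE)
  fix w and v :: 'h assume w: "v \<in> sphere 0 1" "\<forall>n. w n \<in> sphere 0 1" "w \<longlonglongrightarrow> v"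
  have "(\<lambda>n. proj_med P (w n)) \<longlonglongrightarrow> proj_med P v"
    using continuous_on_proj_med w by (simp add: continuous_on_sequentially comp_def)
  then show "(\<lambda>n. proj_MAD P (w n)) \<longlonglongrightarrow> proj_MAD P v"
    unfolding proj_MAD_def MAD_def proj_med_def[symmetric]
    by (intro tendsto_med
        proj_medians_unique_or_finite[OF w(1), of "\<lambda>t. \<bar>t - proj_med P v\<bar>"])
       (auto intro!: tendsto_intros continuous_intros w(3))
qed

lemma closed_directions: "closed (directions P t)"
proof -
  have "directions P t = sphere 0 1 \<inter> proj_MAD P -` {t..}"
    by (auto simp: directions_def)
  then show ?thesis
    using continuous_closed_preimage[OF continuous_on_proj_MAD closed_unit_sphere] by simp
qed

lemma closed_proj_MAD_le: "closed {v \<in> sphere 0 1. proj_MAD P v \<le> t}"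
proof -
  have "{v \<in> sphere 0 1. proj_MAD P v \<le> t} = sphere 0 1 \<inter> proj_MAD P -` {..t}"
    by auto
  then show ?thesis
    using continuous_closed_preimage[OF continuous_on_proj_MAD closed_unit_sphere] by simp
qed

lemma sets_directions [measurable]: "directions P t \<in> sets borel"
  using closed_directions by simp

lemma sets_proj_MAD_le [measurable]: "{v \<in> sphere 0 1. proj_MAD P v \<le> t} \<in> sets borel"
  using closed_proj_MAD_le by simp

text \<open>Where the MAD is positive, the extended quotient is a quotient of continuous real
  functions.\<close>

lemma continuous_on_outlyingness:
  "continuous_on {v \<in> sphere 0 1. 0 < proj_MAD P v} (\<lambda>v. outlyingness P v y)"
proof -
  have "continuous_on {v \<in> sphere 0 1. 0 < proj_MAD P v}
      (\<lambda>v. ennreal (\<bar>y \<bullet> v - proj_med P v\<bar> / proj_MAD P v))"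
    by (intro continuous_on_ennreal continuous_intros
        continuous_on_subset[OF continuous_on_proj_med] continuous_on_subset[OF continuous_on_proj_MAD]) auto
  then show ?thesis
    by (rule continuous_on_cong[THEN iffD1, rotated 2]) (auto simp: outlyingness_def divide_ennreal)
qed

text \<open>A MAD of at most 0 is the midpoint of the median interval of the absolute deviation, so
  the lower end is at most 0 too. Thus the deviation vanishes with probability at least 1/2.\<close>

lemma prob_proj_med_ge_half:
  assumes "proj_MAD P v \<le> 0"
  shows "1/2 \<le> prob {x\<in>space P. x \<bullet> v = proj_med P v}"
proof -
  let ?W = "\<lambda>x. \<bar>x \<bullet> v - proj_med P v\<bar>"
  have "Inf (medians P ?W) \<le> Sup (medians P ?W)"
    by (intro Inf_le_Sup_medians) simp
  moreover have "Inf (medians P ?W) + Sup (medians P ?W) \<le> 0"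
    using assms by (simp add: proj_MAD_def MAD_def proj_med_def[symmetric] med_def[of _ ?W] midpoint_def)
  ultimately have "Inf (medians P ?W) \<le> 0" by linarith
  then show ?thesis
    by (subst (asm) Inf_medians_le_iff) simp_all
qed

end

section \<open>Random directions: full support and almost sure positivity of the MAD\<close>

locale random_projections = projection_law P + nu: prob_space \<nu>
  for P \<nu> :: "'h::{real_inner, second_countable_topology} measure" +
  assumes sets_nu[measurable_cong]: "sets \<nu> = sets borel"
    and atoms: "(SUP y. measure P {y}) < 1/2"
    and full: "msupport \<nu> = sphere 0 1"
    and null: "\<And>w. w \<noteq> 0 \<Longrightarrow> AE v in \<nu>. w \<bullet> v \<noteq> 0"
begin

lemma AE_sphere: "AE v in \<nu>. v \<in> sphere 0 1"
  using AE_in_msupport[OF nu.prob_space_axioms sets_nu] by (simp add: full)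

text \<open>The sphere has full measure, so a relatively open subset has the same measure as any
  open set that cuts it out; the latter meets the support.\<close>

lemma measure_openin_pos:
  assumes "openin (top_of_set (sphere 0 1)) W" "W \<noteq> {}"
  shows "0 < measure \<nu> W"
proof -
  obtain T where T: "open T" "W = sphere 0 1 \<inter> T" using assms(1) by (auto simp: openin_open)
  have "0 < measure \<nu> T"
    using assms(2) T by (intro measure_open_pos nu.prob_space_axioms sets_nu) (auto simp: full)
  also have "measure \<nu> T = measure \<nu> W"
    using AE_sphere T
    by (intro nu.finite_measure_eq_AE)
       (auto simp: sets_nu simp del: dist_0_norm mem_sphere elim: AE_mp
         intro!: sets.Int borel_closed[OF closed_unit_sphere])
  finally show ?thesis .
qed

text \<open>By Fubini, for almost every direction \<open>v\<close> almost no two distinct points of two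
  independent copies have the same projection on \<open>v\<close>, so every atom of the projected law is the
  projection of an atom of \<open>P\<close>.\<close>

lemma AE_proj_MAD_pos: "AE v in \<nu>. 0 < proj_MAD P v"
proof -
  interpret PP: pair_prob_space P P ..
  interpret PN: pair_prob_space "P \<Otimes>\<^sub>M P" \<nu> ..
  have "AE z in P \<Otimes>\<^sub>M P. AE v in \<nu>. fst z - snd z \<noteq> 0 \<longrightarrow> (fst z - snd z) \<bullet> v \<noteq> 0"
  proof (rule AE_I2)
    fix z :: "'h \<times> 'h"
    show "AE v in \<nu>. fst z - snd z \<noteq> 0 \<longrightarrow> (fst z - snd z) \<bullet> v \<noteq> 0"
    proof (cases "fst z - snd z = 0")
      case False
      then show ?thesis using null[OF False] by simp
    qed simp
  qed
  then have "AE v in \<nu>. AE z in P \<Otimes>\<^sub>M P. fst z - snd z \<noteq> 0 \<longrightarrow> (fst z - snd z) \<bullet> v \<noteq> 0"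
    by (subst PN.AE_commute[symmetric]) measurable
  then show "AE v in \<nu>. 0 < proj_MAD P v"
  proof eventually_elim
    fix v assume "AE z in P \<Otimes>\<^sub>M P. fst z - snd z \<noteq> 0 \<longrightarrow> (fst z - snd z) \<bullet> v \<noteq> 0"
    from PP.AE_pair[OF this]
    have ae: "AE x in P. AE y in P. x \<noteq> y \<longrightarrow> x \<bullet> v \<noteq> y \<bullet> v"
      by (simp add: inner_diff_left)
    show "0 < proj_MAD P v"
    proof (rule ccontr)
      let ?A = "{x\<in>space P. x \<bullet> v = proj_med P v}"
      assume "\<not> 0 < proj_MAD P v"
      then have half: "1/2 \<le> prob ?A" by (intro prob_proj_med_ge_half) simp
      \<comment> \<open>As \<open>?A\<close> has positive mass it contains a typical
        \<open>x\<close>. Almost no other point shares the projection of \<open>x\<close>, so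
        \<open>?A\<close> is \<open>{x}\<close> up to a null set, an atom of mass at least
        1/2.\<close>
      have "\<exists>x\<in>?A. AE y in P. x \<noteq> y \<longrightarrow> x \<bullet> v \<noteq> y \<bullet> v"
      proof (rule ccontr)
        assume "\<not> ?thesis"
        then have "AE x in P. x \<notin> ?A" by (intro eventually_mono[OF ae]) blast
        then have "prob ?A \<le> prob {}" by (intro finite_measure_mono_AE) auto
        then show False using half by simp
      qed
      then obtain x where x: "x \<in> ?A" "AE y in P. x \<noteq> y \<longrightarrow> x \<bullet> v \<noteq> y \<bullet> v" by blast
      from x(2) have "prob ?A \<le> prob {x}"
        by (intro finite_measure_mono_AE) (use x(1) in \<open>auto elim!: eventually_mono simp: sets_P\<close>)
      also have "\<dots> \<le> (SUP y. measure P {y})"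
        by (intro cSUP_upper bdd_aboveI2[where M=1]) simp_all
      finally show False using half atoms by linarith
    qed
  qed
qed

end

section \<open>Population quantiles, sample quantiles and relative frequencies\<close>

lemma (in real_distribution) quantile_cdf:
  assumes "0 < u" "u < 1"
  shows "0 \<le> quantile (cdf M) u"
    and "0 \<le> s \<Longrightarrow> s < quantile (cdf M) u \<Longrightarrow> cdf M s < u"
    and "u \<le> cdf M (quantile (cdf M) u)"
proof -
  define S where "S = {z. 0 \<le> z \<and> u \<le> cdf M z}"
  define b where "b = quantile (cdf M) u"
  have b: "b = Inf S" by (simp add: S_def b_def quantile_def)
  have "eventually (\<lambda>z. u < cdf M z) at_top"
    by (rule order_tendstoD(1)[OF cdf_lim_at_top_prob assms(2)])
  then have "eventually (\<lambda>z. 0 \<le> z \<and> u < cdf M z) at_top"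
    using eventually_ge_at_top[of 0] by eventually_elim simp
  then obtain z where "z \<in> S"
    by (auto simp: S_def eventually_at_top_linorder intro: less_imp_le)
  have bdd: "bdd_below S" by (rule bdd_belowI[of _ 0]) (simp add: S_def)
  show "0 \<le> quantile (cdf M) u"
    unfolding b_def[symmetric] b using \<open>z \<in> S\<close> by (intro cInf_greatest) (auto simp: S_def)
  \<comment> \<open>\<open>quantile\<close> is an infimum over nonnegative points, so it says
    nothing about the distribution function at negative \<open>s\<close>.\<close>
  show "cdf M s < u" if "0 \<le> s" "s < quantile (cdf M) u"
  proof (rule ccontr)
    assume "\<not> cdf M s < u"
    then have "s \<in> S" using that by (simp add: S_def)
    then have "b \<le> s" unfolding b using bdd by (rule cInf_lower)
    then show False using that by (simp add: b_def)
  qed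
  have "u \<le> cdf M t" if t: "b < t" for t
  proof -
    obtain s where "s \<in> S" "s < t" using t \<open>z \<in> S\<close> unfolding b by (metis cInf_lessD empty_iff)
    then show ?thesis using cdf_nondecreasing[of s t] by (simp add: S_def)
  qed
  \<comment> \<open>By right continuity the infimum is attained.\<close>
  then show "u \<le> cdf M (quantile (cdf M) u)"
    unfolding b_def[symmetric]
    by (intro tendsto_lowerbound[OF cdf_is_right_cont[of b, unfolded continuous_within]])
       (auto simp: eventually_at_right_field intro!: exI[of _ "b + 1"])
qed

lemma sample_quantile_le:
  assumes "0 \<le> b" "u \<le> real (card {i. i < L \<and> proj_MAD P (d i) \<le> b}) / real L"
  shows "sample_quantile P u L d \<le> b"
  unfolding sample_quantile_def quantile_def
  using assms by (intro cInf_lower bdd_belowI[of _ 0]) auto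

lemma le_sample_quantile:
  assumes "u < 1" "1 \<le> L" "real (card {i. i < L \<and> proj_MAD P (d i) \<le> s}) / real L < u"
  shows "s \<le> sample_quantile P u L d"
  unfolding sample_quantile_def quantile_def
proof (rule cInf_greatest)
  \<comment> \<open>At the largest observed MAD, or 0, the empirical distribution function equals 1;
    hence the set whose infimum is taken is nonempty.\<close>
  define z where "z = Max (insert 0 ((\<lambda>i. proj_MAD P (d i)) ` {..<L}))"
  have "proj_MAD P (d i) \<le> z" if "i < L" for i
    unfolding z_def using that by (intro Max_ge) auto
  then have "{i. i < L \<and> proj_MAD P (d i) \<le> z} = {..<L}" by auto
  moreover have "0 \<le> z" unfolding z_def by (intro Max_ge) auto
  ultimately have "z \<in> {z. 0 \<le> z \<and> u \<le> real (card {i. i < L \<and> proj_MAD P (d i) \<le> z}) / real L}"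
    using assms by simp
  then show "{z. 0 \<le> z \<and> u \<le> real (card {i. i < L \<and> proj_MAD P (d i) \<le> z}) / real L} \<noteq> {}"
    by blast
next
  fix z assume z: "z \<in> {z. 0 \<le> z \<and> u \<le> real (card {i. i < L \<and> proj_MAD P (d i) \<le> z}) / real L}"
  show "s \<le> z"
  proof (rule ccontr)
    assume "\<not> s \<le> z"
    then have "card {i. i < L \<and> proj_MAD P (d i) \<le> z} \<le> card {i. i < L \<and> proj_MAD P (d i) \<le> s}"
      by (intro card_mono) auto
    then have "real (card {i. i < L \<and> proj_MAD P (d i) \<le> z}) / real L
        \<le> real (card {i. i < L \<and> proj_MAD P (d i) \<le> s}) / real L"
      by (intro divide_right_mono) auto
    then show False using z assms(3) by simp
  qed
qed

text \<open>Strong law for indicators: Hoeffding bounds the probability of a deviation by a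
  geometric term in \<open>n\<close>, Borel-Cantelli makes deviations of a given size eventually
  stop, and countably many sizes suffice.\<close>

lemma (in prob_space) relative_frequency_tendsto:
  fixes d :: "nat \<Rightarrow> 'a \<Rightarrow> 'b::topological_space"
  assumes indep: "indep_vars (\<lambda>_. borel) d UNIV"
    and distr: "\<And>i. distr M borel (d i) = N"
    and K[measurable]: "K \<in> sets borel"
  shows "AE \<omega> in M. (\<lambda>n. (\<Sum>i<n. indicat_real K (d i \<omega>)) / real n) \<longlonglongrightarrow> measure N K"
proof -
  have [measurable]: "d i \<in> borel_measurable M" for i
    using indep by (simp add: indep_vars_def)
  define Z where "Z i \<omega> = indicat_real K (d i \<omega>)" for i \<omega>
  have [measurable]: "Z i \<in> borel_measurable M" for i
    unfolding Z_def by measurable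
  have E: "expectation (Z i) = measure N K" for i
  proof -
    have "Z i = indicator (d i -` K)" by (auto simp: Z_def indicator_def fun_eq_iff)
    then show ?thesis by (simp add: distr[of i, symmetric] measure_distr)
  qed
  have "AE \<omega> in M. eventually (\<lambda>n. \<bar>(\<Sum>i<n. Z i \<omega>) / real n - measure N K\<bar> < e) sequentially"
    if "0 < e" for e :: real
  proof -
    define A where "A n = {\<omega>\<in>space M. \<bar>(\<Sum>i<n. Z i \<omega>) - real n * measure N K\<bar> \<ge> real n * e}" for n
    have [measurable]: "A n \<in> sets M" for n unfolding A_def by measurable
    have bound: "prob (A n) \<le> 2 * exp (- 2 * e\<^sup>2) ^ n" for n
    proof (cases "n = 0")
      case True
      then show ?thesis using prob_le_1[of "A n"] by (simp add: order.trans[of _ 1])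
    next
      case False
      \<comment> \<open>The summands lie in an interval of length one, so the sum of squared lengths
        is \<open>n\<close>; \<open>n = 0\<close> is treated apart because this sum must be
        positive.\<close>
      interpret H: Hoeffding_ineq M "{..<n}" Z "\<lambda>_. 0" "\<lambda>_. 1" "\<Sum>i<n. expectation (Z i)"
      proof unfold_locales
        have "indep_vars (\<lambda>_. borel) (\<lambda>i \<omega>. indicat_real K (d i \<omega>)) UNIV"
          by (rule indep_vars_compose2[OF indep]) measurable
        then show "indep_vars (\<lambda>_. borel) Z {..<n}"
          unfolding Z_def by (rule indep_vars_subset) simp
      qed (simp_all add: Z_def)
      have "prob (A n) \<le> 2 * exp (- 2 * (real n * e)\<^sup>2 / real n)"
        using H.Hoeffding_ineq_abs_ge[of "real n * e"] False \<open>0 < e\<close> by (simp add: A_def E)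
      also have "- 2 * (real n * e)\<^sup>2 / real n = real n * (- 2 * e\<^sup>2)"
        using False by (simp add: power2_eq_square)
      finally show ?thesis by (simp only: exp_of_nat_mult)
    qed
    have "summable (\<lambda>n. 2 * exp (- 2 * e\<^sup>2) ^ n)"
      using \<open>0 < e\<close> by (intro summable_mult summable_geometric) simp
    then have "summable (\<lambda>n. prob (A n))"
      by (rule summable_comparison_test'[where N=0]) (use bound in simp)
    then have "AE \<omega> in M. eventually (\<lambda>n. \<omega> \<in> space M - A n) sequentially"
      by (intro borel_cantelli_AE1) (auto simp: emeasure_eq_measure)
    then show ?thesis
    proof eventually_elim
      case (elim \<omega>)
      then show ?case using eventually_gt_at_top[of 0]
      proof eventually_elim
        case (elim n)
        then have "\<bar>(\<Sum>i<n. Z i \<omega>) - real n * measure N K\<bar> / real n < e"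
          by (auto simp: A_def field_simps not_le)
        moreover have "\<bar>(\<Sum>i<n. Z i \<omega>) - real n * measure N K\<bar> / real n
            = \<bar>((\<Sum>i<n. Z i \<omega>) - real n * measure N K) / real n\<bar>"
          by simp
        ultimately show ?case using elim by (simp add: diff_divide_distrib)
      qed
    qed
  qed
  then have "AE \<omega> in M. \<forall>k. eventually (\<lambda>n. \<bar>(\<Sum>i<n. Z i \<omega>) / real n - measure N K\<bar> < inverse (real (Suc k))) sequentially"
    by (subst AE_all_countable) simp
  then show ?thesis
  proof eventually_elim
    case (elim \<omega>)
    show ?case
    proof (rule tendstoI)
      fix e :: real assume "0 < e"
      then obtain k where k: "inverse (real (Suc k)) < e" using reals_Archimedean by blast
      from elim have "eventually (\<lambda>n. \<bar>(\<Sum>i<n. Z i \<omega>) / real n - measure N K\<bar> < inverse (real (Suc k))) sequentially"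
        by blast
      then show "eventually (\<lambda>n. dist ((\<Sum>i<n. indicat_real K (d i \<omega>)) / real n) (measure N K) < e) sequentially"
        by eventually_elim (use k in \<open>simp add: dist_real_def Z_def\<close>)
    qed
  qed
qed

section \<open>Sampled directions: trapping the sample quantile and hitting sets of positive
  measure\<close>

locale sampled_projections = random_projections P \<nu> + Q: prob_space Q
  for P \<nu> :: "'h::{real_inner, second_countable_topology} measure" and Q :: "'w measure" +
  fixes u :: real and d :: "nat \<Rightarrow> 'w \<Rightarrow> 'h" and v :: "nat \<Rightarrow> nat \<Rightarrow> 'w \<Rightarrow> 'h"
  assumes u: "0 < u" "u < 1"
    and sampling: "direction_sampling Q \<nu> P u d v"
begin

text \<open>Intersecting with the sphere, where \<open>proj_MAD P\<close> is continuous, makes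
  \<open>K t\<close> closed and hence Borel.\<close>

abbreviation "K t \<equiv> {w \<in> sphere 0 1. proj_MAD P w \<le> t}"
abbreviation "F t \<equiv> measure \<nu> (K t)"
abbreviation "quant L \<omega> \<equiv> sample_quantile P u L (\<lambda>i. d i \<omega>)"
abbreviation "past L \<equiv>
  vimage_algebra (space Q) (\<lambda>\<omega>. \<lambda>i\<in>{..<L}. d i \<omega>) (PiM {..<L} (\<lambda>_. borel :: 'h measure))"

text \<open>\<open>freq L (K t)\<close> is almost surely the empirical distribution function of the
  MADs at \<open>t\<close>. Bounds on the sample quantile are expressed through it, since it is
  visibly measurable with respect to \<open>past L\<close>.\<close>

definition freq :: "nat \<Rightarrow> 'h set \<Rightarrow> 'w \<Rightarrow> real" where
  "freq L B \<omega> = (\<Sum>i<L. indicat_real B (d i \<omega>)) / real L"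

lemma indep_d: "Q.indep_vars (\<lambda>_. borel) d UNIV" and distr_d: "distr Q borel (d i) = \<nu>"
  and v_measurable [measurable]: "v L m \<in> borel_measurable Q"
  and cond_v: "1 \<le> L \<Longrightarrow> (\<And>j. j < M \<Longrightarrow> B j \<in> sets borel) \<Longrightarrow>
       AE \<omega> in Q. real_cond_exp Q (past L) (indicator {\<omega> \<in> space Q. \<forall>j<M. v L j \<omega> \<in> B j}) \<omega>
          = (\<Prod>j<M. measure (uniform_measure \<nu> (directions P (quant L \<omega>))) (B j))"
  using sampling by (auto simp: direction_sampling_def)

lemma d_measurable [measurable]: "d i \<in> borel_measurable Q"
  using indep_d by (simp add: Q.indep_vars_def)

lemma AE_d_sphere: "AE \<omega> in Q. \<forall>i. d i \<omega> \<in> sphere 0 1"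
proof -
  have "AE \<omega> in Q. d i \<omega> \<in> sphere 0 1" for i
    using AE_sphere unfolding distr_d[of i, symmetric] by (rule AE_distrD[rotated]) simp
  then show ?thesis by (subst AE_all_countable) simp
qed

lemma freq_eq_card: "freq L B \<omega> = real (card {i. i < L \<and> d i \<omega> \<in> B}) / real L"
proof -
  have "(\<Sum>i<L. indicat_real B (d i \<omega>)) = (\<Sum>i\<in>{..<L} \<inter> {i. d i \<omega> \<in> B}. 1)"
    by (simp add: indicator_def sum.If_cases)
  moreover have "{..<L} \<inter> {i. d i \<omega> \<in> B} = {i. i < L \<and> d i \<omega> \<in> B}" by auto
  ultimately show ?thesis by (simp add: freq_def)
qed

lemma quant_le:
  assumes "0 \<le> b" "\<forall>i. d i \<omega> \<in> sphere 0 1" "u \<le> freq L (K b) \<omega>"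
  shows "quant L \<omega> \<le> b"
  using assms by (intro sample_quantile_le) (simp_all add: freq_eq_card)

lemma le_quant:
  assumes "1 \<le> L" "\<forall>i. d i \<omega> \<in> sphere 0 1" "freq L (K s) \<omega> < u"
  shows "s \<le> quant L \<omega>"
  using assms u by (intro le_sample_quantile) (simp_all add: freq_eq_card)

lemma freq_tendsto: "AE \<omega> in Q. (\<lambda>L. freq L (K t) \<omega>) \<longlonglongrightarrow> F t"
  unfolding freq_def by (rule Q.relative_frequency_tendsto[OF indep_d distr_d]) measurable

lemma d_measurable_past: "i < L \<Longrightarrow> d i \<in> borel_measurable (past L)"
proof -
  assume i: "i < L"
  have "(\<lambda>\<omega>. \<lambda>i\<in>{..<L}. d i \<omega>) \<in> past L \<rightarrow>\<^sub>M PiM {..<L} (\<lambda>_. borel)"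
    by (rule measurable_vimage_algebra1) (auto simp: space_PiM)
  moreover have "(\<lambda>f. f i) \<in> PiM {..<L} (\<lambda>_. borel :: 'h measure) \<rightarrow>\<^sub>M borel"
    using i by (intro measurable_component_singleton) simp
  ultimately have "(\<lambda>\<omega>. (\<lambda>i\<in>{..<L}. d i \<omega>) i) \<in> past L \<rightarrow>\<^sub>M borel"
    by (rule measurable_compose)
  then show ?thesis using i by simp
qed

lemma freq_measurable_past:
  assumes [measurable]: "B \<in> sets borel"
  shows "freq L B \<in> borel_measurable (past L)"
  unfolding freq_def
proof (intro borel_measurable_divide borel_measurable_sum)
  fix i assume "i \<in> {..<L}"
  then have [measurable]: "d i \<in> borel_measurable (past L)" by (simp add: d_measurable_past)
  show "(\<lambda>\<omega>. indicat_real B (d i \<omega>)) \<in> borel_measurable (past L)" by measurable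
qed simp

lemma subalgebra_past: "subalgebra Q (past L)"
  unfolding subalgebra_def
proof
  show "sets (past L) \<subseteq> sets Q"
    by (rule sets_image_in_sets) (simp, measurable)
qed simp

text \<open>Integrates the conditional product formula over an event \<open>E\<close> of the past,
  so that an almost sure bound on the product over \<open>E\<close> becomes a bound on a
  probability.\<close>

lemma prob_cond_le:
  assumes "1 \<le> L" "0 \<le> r" and B: "\<And>j. j < M \<Longrightarrow> B j \<in> sets borel"
    and E: "E \<in> sets (past L)"
    and r: "AE \<omega> in Q. \<omega> \<in> E \<longrightarrow>
      (\<Prod>j<M. measure (uniform_measure \<nu> (directions P (quant L \<omega>))) (B j)) \<le> r"
  shows "Q.prob (E \<inter> {\<omega>\<in>space Q. \<forall>j<M. v L j \<omega> \<in> B j}) \<le> r"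
proof -
  interpret S: finite_measure_subalgebra Q "past L"
    by unfold_locales (rule subalgebra_past)
  define C where "C = {\<omega>\<in>space Q. \<forall>j<M. v L j \<omega> \<in> B j}"
  have "C = {\<omega>\<in>space Q. \<forall>j\<in>{..<M}. v L j \<omega> \<in> B j}" by (auto simp: C_def)
  also have "\<dots> \<in> sets Q"
  proof (rule sets.sets_Collect_finite_All)
    fix j assume "j \<in> {..<M}"
    then have [measurable]: "B j \<in> sets borel" using B by simp
    show "{\<omega>\<in>space Q. v L j \<omega> \<in> B j} \<in> sets Q" by measurable
  qed simp
  finally have C[measurable]: "C \<in> sets Q" .
  have EQ[measurable]: "E \<in> sets Q" using E subalgebra_past[of L] by (auto simp: subalgebra_def)
  have cond: "AE \<omega> in Q. real_cond_exp Q (past L) (indicator C) \<omega>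
      = (\<Prod>j<M. measure (uniform_measure \<nu> (directions P (quant L \<omega>))) (B j))"
    unfolding C_def by (rule cond_v[OF \<open>1 \<le> L\<close> B])
  have int: "integrable Q (indicat_real C)" by (intro integrable_real_indicator C) (simp add: Q.emeasure_eq_measure)
  have "Q.prob (E \<inter> C) = (\<integral>\<omega>\<in>E. indicat_real C \<omega> \<partial>Q)"
    using C EQ by (simp add: set_lebesgue_integral_def indicator_inter_arith[symmetric])
  also have "\<dots> = (\<integral>\<omega>\<in>E. real_cond_exp Q (past L) (indicator C) \<omega> \<partial>Q)"
    by (rule S.real_cond_exp_intA[OF int E])
  also have "\<dots> \<le> (\<integral>\<omega>. r \<partial>Q)"
    unfolding set_lebesgue_integral_def
  proof (rule integral_mono_AE)
    show "integrable Q (\<lambda>\<omega>. indicat_real E \<omega> *\<^sub>R real_cond_exp Q (past L) (indicator C) \<omega>)"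
      by (intro integrable_mult_indicator EQ S.real_cond_exp_int int)
    show "AE \<omega> in Q. indicat_real E \<omega> *\<^sub>R real_cond_exp Q (past L) (indicator C) \<omega> \<le> r"
      using cond r
      by eventually_elim (use \<open>0 \<le> r\<close> in \<open>simp add: indicator_def\<close>)
  qed simp
  also have "\<dots> = r" by (simp add: Q.prob_space)
  finally show ?thesis by (simp only: C_def)
qed

text \<open>A frequency below \<open>u\<close> at \<open>s\<close> forces the sample quantile to be
  at least \<open>s\<close>, and then the conditional law gives no mass to the complement of
  \<open>directions P s\<close>.\<close>

lemma AE_v_in_directions:
  assumes "1 \<le> L"
  shows "AE \<omega> in Q. freq L (K s) \<omega> < u \<longrightarrow> (\<forall>m. v L m \<omega> \<in> directions P s)"
proof -
  define E where "E = {\<omega>\<in>space (past L). freq L (K s) \<omega> < u}"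
  have E: "E \<in> sets (past L)"
  proof -
    have [measurable]: "freq L (K s) \<in> borel_measurable (past L)"
      by (rule freq_measurable_past) measurable
    show ?thesis unfolding E_def by measurable
  qed
  have [measurable]: "E \<in> sets Q" using E subalgebra_past[of L] by (auto simp: subalgebra_def)
  have "AE \<omega> in Q. \<omega> \<in> E \<longrightarrow> v L m \<omega> \<in> directions P s" for m
  proof -
    \<comment> \<open>Only draw \<open>m\<close> is constrained; among the first
      \<open>Suc m\<close> draws its factor makes the whole product vanish on
      \<open>E\<close>.\<close>
    define B where "B j = (if j = m then - directions P s else UNIV)" for j
    have B[measurable]: "B j \<in> sets borel" for j by (simp add: B_def)
    have "Q.prob (E \<inter> {\<omega>\<in>space Q. \<forall>j<Suc m. v L j \<omega> \<in> B j}) \<le> 0"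
    proof (rule prob_cond_le[OF assms _ B E])
      show "AE \<omega> in Q. \<omega> \<in> E \<longrightarrow>
        (\<Prod>j<Suc m. measure (uniform_measure \<nu> (directions P (quant L \<omega>))) (B j)) \<le> 0"
        using AE_d_sphere
      proof eventually_elim
        case (elim \<omega>)
        show ?case
        proof
          assume "\<omega> \<in> E"
          then have "s \<le> quant L \<omega>"
            using le_quant[OF assms elim] by (simp add: E_def)
          then have "directions P (quant L \<omega>) \<inter> B m = {}" by (auto simp: directions_def B_def)
          \<comment> \<open>This covers a null conditioning set as well, because 0 / 0 = 0 for
            extended reals.\<close>
          then have "measure (uniform_measure \<nu> (directions P (quant L \<omega>))) (B m) = 0"
            by (simp add: measure_def sets_nu)
          then show "(\<Prod>j<Suc m. measure (uniform_measure \<nu> (directions P (quant L \<omega>))) (B j)) \<le> 0"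
            by simp
        qed
      qed
    qed simp
    moreover have "{\<omega>\<in>space Q. \<not> (\<omega> \<in> E \<longrightarrow> v L m \<omega> \<in> directions P s)}
        = E \<inter> {\<omega>\<in>space Q. \<forall>j<Suc m. v L j \<omega> \<in> B j}"
      by (auto simp: B_def E_def)
    moreover have "{\<omega>\<in>space Q. \<not> (\<omega> \<in> E \<longrightarrow> v L m \<omega> \<in> directions P s)} \<in> sets Q"
      by measurable
    ultimately show ?thesis
      by (intro AE_I[OF subset_refl]) (simp_all add: Q.emeasure_eq_measure measure_le_0_iff)
  qed
  then have "AE \<omega> in Q. \<forall>m. \<omega> \<in> E \<longrightarrow> v L m \<omega> \<in> directions P s"
    by (subst AE_all_countable) simp
  with AE_space show ?thesis by eventually_elim (simp add: E_def)
qed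

text \<open>On this event the sample quantile is at most \<open>b\<close>, so \<open>B\<close> lies
  in the conditioning set. Conditioning only enlarges the mass of \<open>B\<close>, hence each draw
  misses with probability at most \<open>1 - measure \<nu> B\<close>, whatever \<open>L\<close>
  is.\<close>

lemma prob_miss_le:
  assumes "1 \<le> L" "0 \<le> b" and B[measurable]: "B \<in> sets borel"
    and "0 < measure \<nu> B" "B \<subseteq> directions P b"
  shows "{\<omega>\<in>space Q. u \<le> freq L (K b) \<omega> \<and> (\<forall>j<M. v L j \<omega> \<notin> B)} \<in> sets Q"
    and "Q.prob {\<omega>\<in>space Q. u \<le> freq L (K b) \<omega> \<and> (\<forall>j<M. v L j \<omega> \<notin> B)} \<le> (1 - measure \<nu> B) ^ M"
proof -
  define E where "E = {\<omega>\<in>space (past L). u \<le> freq L (K b) \<omega>}"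
  have E: "E \<in> sets (past L)"
  proof -
    have [measurable]: "freq L (K b) \<in> borel_measurable (past L)"
      by (rule freq_measurable_past) measurable
    show ?thesis unfolding E_def by measurable
  qed
  have [measurable]: "E \<in> sets Q" using E subalgebra_past[of L] by (auto simp: subalgebra_def)
  have eq: "{\<omega>\<in>space Q. u \<le> freq L (K b) \<omega> \<and> (\<forall>j<M. v L j \<omega> \<notin> B)}
      = E \<inter> {\<omega>\<in>space Q. \<forall>j<M. v L j \<omega> \<in> - B}"
    by (auto simp: E_def)
  have "E \<inter> {\<omega>\<in>space Q. \<forall>j\<in>{..<M}. v L j \<omega> \<in> - B} \<in> sets Q"
    by measurable
  then show "{\<omega>\<in>space Q. u \<le> freq L (K b) \<omega> \<and> (\<forall>j<M. v L j \<omega> \<notin> B)} \<in> sets Q"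
    unfolding eq by simp
  show "Q.prob {\<omega>\<in>space Q. u \<le> freq L (K b) \<omega> \<and> (\<forall>j<M. v L j \<omega> \<notin> B)} \<le> (1 - measure \<nu> B) ^ M"
    unfolding eq
  proof (rule prob_cond_le[OF assms(1) _ _ E])
    show "AE \<omega> in Q. \<omega> \<in> E \<longrightarrow>
      (\<Prod>j<M. measure (uniform_measure \<nu> (directions P (quant L \<omega>))) (- B)) \<le> (1 - measure \<nu> B) ^ M"
      using AE_d_sphere
    proof eventually_elim
      case (elim \<omega>)
      show ?case
      proof
        assume "\<omega> \<in> E"
        let ?V = "directions P (quant L \<omega>)"
        have "quant L \<omega> \<le> b"
          using \<open>\<omega> \<in> E\<close> quant_le[OF assms(2) elim] by (simp add: E_def)
        then have BV: "B \<subseteq> ?V" using assms(5) by (auto simp: directions_def)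
        then have le: "measure \<nu> B \<le> measure \<nu> ?V"
          by (intro nu.finite_measure_mono) (simp_all add: sets_nu)
        then have pos: "0 < measure \<nu> ?V" using assms(4) by simp
        have "?V \<inter> - B = ?V - B" by auto
        then have "measure (uniform_measure \<nu> ?V) (- B) = measure \<nu> (?V - B) / measure \<nu> ?V"
          using pos by (subst measure_uniform_measure) (simp_all add: sets_nu nu.emeasure_eq_measure)
        also have "\<dots> = (measure \<nu> ?V - measure \<nu> B) / measure \<nu> ?V"
          using BV by (subst nu.finite_measure_Diff) (simp_all add: sets_nu)
        also have "\<dots> = 1 - measure \<nu> B / measure \<nu> ?V"
          using pos by (simp add: diff_divide_distrib)
        also have "\<dots> \<le> 1 - measure \<nu> B"
          using pos nu.prob_le_1[of ?V] by (simp add: le_divide_eq mult_left_le)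
        finally have "measure (uniform_measure \<nu> ?V) (- B) ^ M \<le> (1 - measure \<nu> B) ^ M"
          by (intro power_mono) simp_all
        then show "(\<Prod>j<M. measure (uniform_measure \<nu> ?V) (- B)) \<le> (1 - measure \<nu> B) ^ M"
          by simp
      qed
    qed
  qed simp_all
qed

lemma AE_hit:
  assumes "1 \<le> L" "0 \<le> b" "B \<in> sets borel" "0 < measure \<nu> B" "B \<subseteq> directions P b"
  shows "AE \<omega> in Q. u \<le> freq L (K b) \<omega> \<longrightarrow> (\<exists>j. v L j \<omega> \<in> B)"
proof -
  let ?A = "\<lambda>M. {\<omega>\<in>space Q. u \<le> freq L (K b) \<omega> \<and> (\<forall>j<M. v L j \<omega> \<notin> B)}"
  have "summable (\<lambda>M. Q.prob (?A M))"
    by (rule summable_comparison_test'[where N=0 and g="\<lambda>M. (1 - measure \<nu> B) ^ M"])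
       (use assms(4) prob_miss_le(2)[OF assms] in \<open>simp_all add: summable_geometric\<close>)
  then have "AE \<omega> in Q. eventually (\<lambda>M. \<omega> \<in> space Q - ?A M) sequentially"
    by (intro borel_cantelli_AE1 prob_miss_le(1)[OF assms]) (simp_all add: Q.emeasure_eq_measure)
  then show ?thesis
    by eventually_elim (auto dest: eventually_happens)
qed

text \<open>Because the miss bound is geometric in \<open>M\<close> and uniform in \<open>L\<close>,
  it is summable along any choice \<open>L = l M\<close>. Borel-Cantelli in this direction asks
  nothing of the dependence between samples for different \<open>L\<close>.\<close>

lemma AE_eventually_hit:
  assumes "\<And>M. 1 \<le> l M" "0 \<le> b" "B \<in> sets borel" "0 < measure \<nu> B" "B \<subseteq> directions P b"
  shows "AE \<omega> in Q. eventually (\<lambda>M. u \<le> freq (l M) (K b) \<omega> \<longrightarrow> (\<exists>j<M. v (l M) j \<omega> \<in> B)) sequentially"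
proof -
  let ?A = "\<lambda>M. {\<omega>\<in>space Q. u \<le> freq (l M) (K b) \<omega> \<and> (\<forall>j<M. v (l M) j \<omega> \<notin> B)}"
  have "summable (\<lambda>M. Q.prob (?A M))"
    by (rule summable_comparison_test'[where N=0 and g="\<lambda>M. (1 - measure \<nu> B) ^ M"])
       (use assms(4) prob_miss_le(2)[OF assms] in \<open>simp_all add: summable_geometric\<close>)
  then have "AE \<omega> in Q. eventually (\<lambda>M. \<omega> \<in> space Q - ?A M) sequentially"
    by (intro borel_cantelli_AE1 prob_miss_le(1)[OF assms]) (simp_all add: Q.emeasure_eq_measure)
  then show ?thesis
    by eventually_elim (auto elim: eventually_mono)
qed

end

section \<open>The depth as a function of the MAD level\<close>

lemma antimono_inverse_1_plus_ennreal: "antimono (\<lambda>c::ennreal. inverse (1 + c))"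
proof (rule antimonoI)
  fix a b :: ennreal assume "a \<le> b"
  then show "inverse (1 + b) \<le> inverse (1 + a)"
    by (cases a; cases b)
       (auto simp: ennreal_1[symmetric] inverse_ennreal simp flip: ennreal_plus simp del: ennreal_1
         intro!: ennreal_leI le_imp_inverse_le simp: top_unique)
qed

lemma continuous_inverse_1_plus_ennreal: "continuous_on UNIV (\<lambda>c::ennreal. inverse (1 + c))"
  by (intro continuous_on_inverse_ennreal continuous_on_add_ennreal continuous_intros)

text \<open>A continuous decreasing map turns the supremum into an infimum. Over an empty set of
  directions the two sides would be \<open>top\<close> and 1.\<close>

lemma reg_depth_eq:
  assumes "directions P t \<noteq> {}"
  shows "reg_depth P t y = inverse (1 + max_outlyingness P y t)"
proof -
  have "inverse (1 + max_outlyingness P y t)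
      = (INF c\<in>(\<lambda>v. outlyingness P v y) ` directions P t. inverse (1 + c))"
    unfolding max_outlyingness_def
  proof (rule continuous_at_Sup_antimono[OF antimono_inverse_1_plus_ennreal])
    show "continuous (at_left (Sup ((\<lambda>v. outlyingness P v y) ` directions P t))) (\<lambda>c::ennreal. inverse (1 + c))"
      using continuous_inverse_1_plus_ennreal
      by (auto simp: continuous_on_eq_continuous_at intro: continuous_at_imp_continuous_at_within)
  qed (use assms in auto)
  then show ?thesis by (simp add: reg_depth_def image_image)
qed

lemma reg_depth_tendsto:
  assumes "continuous (at b within {0..}) (max_outlyingness P y)" "0 \<le> b"
    and "\<And>k. 0 \<le> t k" "t \<longlonglongrightarrow> b" "\<And>k. directions P (t k) \<noteq> {}" "directions P b \<noteq> {}"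
  shows "(\<lambda>k. reg_depth P (t k) y) \<longlonglongrightarrow> reg_depth P b y"
proof -
  have "(\<lambda>k. max_outlyingness P y (t k)) \<longlonglongrightarrow> max_outlyingness P y b"
    using assms by (intro continuous_within_tendsto_compose'[OF assms(1)]) auto
  then have "(\<lambda>k. inverse (1 + max_outlyingness P y (t k))) \<longlonglongrightarrow> inverse (1 + max_outlyingness P y b)"
    by (intro continuous_on_tendsto_compose[OF continuous_inverse_1_plus_ennreal]) auto
  then show ?thesis using assms by (simp add: reg_depth_eq)
qed

lemma reg_depth_le_approx_depth:
  assumes "1 \<le> M" "\<And>m. v m \<in> directions P t"
  shows "reg_depth P t y \<le> approx_depth P M v y"
  unfolding approx_depth_def
  using assms by (subst Min_ge_iff) (auto simp: reg_depth_def lessThan_empty_iff intro: INF_lower)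

lemma approx_depth_le:
  assumes "j < M" "inverse (1 + outlyingness P (v j) y) \<le> a"
  shows "approx_depth P M v y \<le> a"
  unfolding approx_depth_def using assms by (intro Min.coboundedI[THEN order.trans]) auto

text \<open>Squeezing by countably many constant bounds suits almost sure arguments: each
  \<open>k\<close> costs one null set.\<close>

lemma tendsto_squeeze_sequences:
  fixes f :: "'a \<Rightarrow> 'b::order_topology"
  assumes "\<And>k::nat. eventually (\<lambda>x. lo k \<le> f x) G" "\<And>k::nat. eventually (\<lambda>x. f x \<le> hi k) G"
    and "lo \<longlonglongrightarrow> c" "hi \<longlonglongrightarrow> c"
  shows "(f \<longlongrightarrow> c) G"
proof (rule order_tendstoI)
  fix a assume "a < c"
  then have "eventually (\<lambda>k. a < lo k) sequentially" using assms(3) by (rule order_tendstoD(1)[rotated])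
  then obtain k where "a < lo k" by (auto dest: eventually_happens)
  then show "eventually (\<lambda>x. a < f x) G"
    using assms(1)[of k] by (auto elim: eventually_mono)
next
  fix a assume "c < a"
  then have "eventually (\<lambda>k. hi k < a) sequentially" using assms(4) by (rule order_tendstoD(2)[rotated])
  then obtain k where "hi k < a" by (auto dest: eventually_happens)
  then show "eventually (\<lambda>x. f x < a) G"
    using assms(2)[of k] by (auto elim: eventually_mono)
qed

context random_projections
begin

text \<open>\<open>directions P b\<close> is closed and may contain no relatively open set, so the
  level is lowered to \<open>b'\<close>: the directions with MAD above \<open>b'\<close> form a
  relatively open set containing it. Inside it, near optimality for level \<open>b\<close> is an
  open condition, and full support gives positive measure.\<close>

lemma near_optimal_directions:
  assumes "0 \<le> b'" "b' < b" "directions P b \<noteq> {}" "0 < e"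
  obtains B where "B \<in> sets borel" "0 < measure \<nu> B" "B \<subseteq> directions P b'"
    "\<And>w. w \<in> B \<Longrightarrow> inverse (1 + outlyingness P w x) \<le> reg_depth P b x + e"
proof -
  let ?S = "sphere 0 1 :: 'h set"
  define W where "W = ?S \<inter> proj_MAD P -` {b'<..}"
  define B where "B = W \<inter> (\<lambda>w. inverse (1 + outlyingness P w x)) -` {..<reg_depth P b x + e}"
  have W: "openin (top_of_set ?S) W"
    unfolding W_def by (intro continuous_openin_preimage_gen continuous_on_proj_MAD) simp
  have "continuous_on W (\<lambda>w. outlyingness P w x)"
    using assms(1) by (intro continuous_on_subset[OF continuous_on_outlyingness]) (auto simp: W_def)
  then have "continuous_on W (\<lambda>w. inverse (1 + outlyingness P w x))"
    by (rule continuous_on_compose2[OF continuous_inverse_1_plus_ennreal]) simp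
  then have "openin (top_of_set W) B"
    unfolding B_def by (rule continuous_openin_preimage_gen) simp
  then have B: "openin (top_of_set ?S) B" using W by (rule openin_trans)
  obtain w where w: "w \<in> directions P b" using assms(3) by blast
  \<comment> \<open>The depth is finite, so adding \<open>e\<close> increases it strictly; this
    fails at \<open>top\<close>.\<close>
  have "reg_depth P b x \<le> inverse (1 + outlyingness P w x)"
    unfolding reg_depth_def using w by (rule INF_lower)
  also have "\<dots> < top" by (simp add: less_top[symmetric])
  finally have "reg_depth P b x < reg_depth P b x + e"
    using assms(4) ennreal_add_left_cancel_less[of "reg_depth P b x" 0 e] by simp
  then obtain w where w: "w \<in> directions P b" "inverse (1 + outlyingness P w x) < reg_depth P b x + e"
    unfolding reg_depth_def[of P b x] INF_less_iff by blast
  then have "w \<in> B" using assms(2) by (auto simp: B_def W_def directions_def)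
  show thesis
  proof
    obtain T where "open T" "B = ?S \<inter> T" using B by (auto simp: openin_open)
    then show "B \<in> sets borel" by (simp add: sets.Int borel_closed[OF closed_unit_sphere])
    show "0 < measure \<nu> B" using \<open>w \<in> B\<close> by (intro measure_openin_pos B) blast
    show "B \<subseteq> directions P b'" by (auto simp: B_def W_def directions_def)
    show "inverse (1 + outlyingness P w x) \<le> reg_depth P b x + e" if "w \<in> B" for w
      using that by (simp add: B_def less_imp_le)
  qed
qed

end

section \<open>Almost sure convergence of the approximated depth\<close>

context sampled_projections
begin

text \<open>Three readings of the double limit. The miss bound does not decay in \<open>L\<close>,
  so Borel-Cantelli cannot be summed over all pairs, and the full double limit relies on a common
  proposal sequence. Limits along \<open>L = l M\<close> and the iterated limit hold for every
  coupling of the samples.\<close>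

lemma approx_depth_converges:
  assumes "0 < b0"
    and below: "\<And>s. 0 \<le> s \<Longrightarrow> s < b0 \<Longrightarrow> F s < u"
    and above: "\<And>t. b0 < t \<Longrightarrow> u < F t"
    and beyond: "\<exists>w\<in>sphere 0 1. b0 < proj_MAD P w"
    and cont: "continuous (at b0 within {0..}) (max_outlyingness P x)"
  defines "D \<equiv> \<lambda>M L \<omega>. approx_depth P M (\<lambda>m. v L m \<omega>) x"
  shows "common_proposals Q P u d v w \<Longrightarrow>
      AE \<omega> in Q. ((\<lambda>(M, L). D M L \<omega>) \<longlongrightarrow> reg_depth P b0 x) (sequentially \<times>\<^sub>F sequentially)"
    and "filterlim l sequentially sequentially \<Longrightarrow>
      AE \<omega> in Q. (\<lambda>M. D M (l M) \<omega>) \<longlonglongrightarrow> reg_depth P b0 x"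
    and "AE \<omega> in Q. \<exists>lim. (\<forall>L\<ge>1. (\<lambda>M. D M L \<omega>) \<longlonglongrightarrow> lim L) \<and> lim \<longlonglongrightarrow> reg_depth P b0 x"
proof -
  obtain w0 where w0: "w0 \<in> sphere 0 1" "b0 < proj_MAD P w0" using beyond by blast
  have nonempty: "directions P t \<noteq> {}" if "t \<le> proj_MAD P w0" for t
    using that w0 by (auto simp: directions_def)
  \<comment> \<open>The room above \<open>b0\<close>: levels up to \<open>b0 + \<eta>\<close> still
    admit the direction \<open>w0\<close>.\<close>
  define \<eta> where "\<eta> = proj_MAD P w0 - b0"
  have "0 < \<eta>" using w0 by (simp add: \<eta>_def)
  define q where "q k = inverse (real (Suc k))" for k
  have q: "0 < q k" "q k \<le> 1" for k
    by (simp_all add: q_def inverse_le_1_iff)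
  have q_lim: "q \<longlonglongrightarrow> 0"
    unfolding q_def[abs_def] by (rule LIMSEQ_inverse_real_of_nat)
  \<comment> \<open>All levels tend to \<open>b0\<close>, with \<open>s k < b0 < b k < c k\<close>.
    The gap between \<open>b0\<close> and \<open>b k\<close> traps the sample quantile, the gap
    between \<open>b k\<close> and \<open>c k\<close> feeds \<open>near_optimal_directions\<close>,
    and \<open>q k \<le> 1\<close> keeps \<open>s k\<close> nonnegative and \<open>c k\<close>
    attainable.\<close>
  define s where "s k = b0 - b0 * q k" for k
  define c where "c k = b0 + \<eta> * q k" for k
  define b where "b k = b0 + \<eta> * q k / 2" for k
  have s: "0 \<le> s k" "s k < b0" for k
    using q[of k] \<open>0 < b0\<close> by (simp_all add: s_def mult_le_cancel_left2)
  have b: "b0 < b k" "b k < c k" "0 \<le> b k" for k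
    using q[of k] \<open>0 < b0\<close> \<open>0 < \<eta>\<close> by (simp_all add: b_def c_def add_nonneg_nonneg)
  have c: "0 \<le> c k" "directions P (c k) \<noteq> {}" for k
  proof -
    have "\<eta> * q k \<le> \<eta>" using q[of k] \<open>0 < \<eta>\<close> by (simp add: mult_le_cancel_left2)
    then show "directions P (c k) \<noteq> {}" by (intro nonempty) (simp add: c_def \<eta>_def)
    show "0 \<le> c k" using b[of k] by linarith
  qed
  have "s \<longlonglongrightarrow> b0 - b0 * 0" unfolding s_def[abs_def] by (intro tendsto_intros q_lim)
  then have lo: "(\<lambda>k. reg_depth P (s k) x) \<longlonglongrightarrow> reg_depth P b0 x"
    using s w0 \<open>0 < b0\<close>
    by (intro reg_depth_tendsto[OF cont] nonempty less_imp_le[OF order.strict_trans[OF s(2) w0(2)]]) auto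
  have "c \<longlonglongrightarrow> b0 + \<eta> * 0" unfolding c_def[abs_def] by (intro tendsto_intros q_lim)
  then have "(\<lambda>k. reg_depth P (c k) x) \<longlonglongrightarrow> reg_depth P b0 x"
    using c w0 \<open>0 < b0\<close> by (intro reg_depth_tendsto[OF cont] nonempty[of b0]) auto
  moreover have "(\<lambda>k. ennreal (q k)) \<longlonglongrightarrow> ennreal 0" by (intro tendsto_ennrealI q_lim)
  ultimately have "(\<lambda>k. reg_depth P (c k) x + ennreal (q k)) \<longlonglongrightarrow> reg_depth P b0 x + ennreal 0"
    by (rule tendsto_add)
  then have hi: "(\<lambda>k. reg_depth P (c k) x + ennreal (q k)) \<longlonglongrightarrow> reg_depth P b0 x" by simp
  have "\<exists>B. B \<in> sets borel \<and> 0 < measure \<nu> B \<and> B \<subseteq> directions P (b k) \<and>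
      (\<forall>w\<in>B. inverse (1 + outlyingness P w x) \<le> reg_depth P (c k) x + ennreal (q k))" for k
    by (rule near_optimal_directions[of "b k" "c k" "ennreal (q k)" x]) (use b c q in auto)
  then obtain B where B: "\<And>k. B k \<in> sets borel" "\<And>k. 0 < measure \<nu> (B k)"
      "\<And>k. B k \<subseteq> directions P (b k)"
      "\<And>k w. w \<in> B k \<Longrightarrow> inverse (1 + outlyingness P w x) \<le> reg_depth P (c k) x + ennreal (q k)"
    by metis
  have freq_lo: "AE \<omega> in Q. \<forall>k. eventually (\<lambda>L. freq L (K (s k)) \<omega> < u) sequentially"
    unfolding AE_all_countable
  proof
    fix k
    show "AE \<omega> in Q. eventually (\<lambda>L. freq L (K (s k)) \<omega> < u) sequentially"
      using freq_tendsto[of "s k"] 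
    proof eventually_elim
      case (elim \<omega>)
      then show ?case using below[OF s] by (rule order_tendstoD(2))
    qed
  qed
  have freq_hi: "AE \<omega> in Q. \<forall>k. eventually (\<lambda>L. u \<le> freq L (K (b k)) \<omega>) sequentially"
    unfolding AE_all_countable
  proof
    fix k
    show "AE \<omega> in Q. eventually (\<lambda>L. u \<le> freq L (K (b k)) \<omega>) sequentially"
      using freq_tendsto[of "b k"]
    proof eventually_elim
      case (elim \<omega>)
      then have "eventually (\<lambda>L. u < freq L (K (b k)) \<omega>) sequentially"
        using above[OF b(1)] by (rule order_tendstoD(1))
      then show ?case by eventually_elim simp
    qed
  qed
  have inside: "AE \<omega> in Q. \<forall>k L. 1 \<le> L \<longrightarrow> freq L (K (s k)) \<omega> < u \<longrightarrow>
      (\<forall>m. v L m \<omega> \<in> directions P (s k))"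
    unfolding AE_all_countable
  proof (intro allI)
    fix k L
    show "AE \<omega> in Q. 1 \<le> L \<longrightarrow> freq L (K (s k)) \<omega> < u \<longrightarrow> (\<forall>m. v L m \<omega> \<in> directions P (s k))"
      using AE_v_in_directions[of L "s k"] by (cases "1 \<le> L") simp_all
  qed
  have hit: "AE \<omega> in Q. \<forall>k L. 1 \<le> L \<longrightarrow> u \<le> freq L (K (b k)) \<omega> \<longrightarrow> (\<exists>j. v L j \<omega> \<in> B k)"
    unfolding AE_all_countable
  proof (intro allI)
    fix k L
    show "AE \<omega> in Q. 1 \<le> L \<longrightarrow> u \<le> freq L (K (b k)) \<omega> \<longrightarrow> (\<exists>j. v L j \<omega> \<in> B k)"
      using AE_hit[OF _ b(3) B(1-3), of L k] by (cases "1 \<le> L") simp_all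
  qed

  have lower: "reg_depth P (s k) x \<le> D M L \<omega>"
    if "\<forall>k L. 1 \<le> L \<longrightarrow> freq L (K (s k)) \<omega> < u \<longrightarrow> (\<forall>m. v L m \<omega> \<in> directions P (s k))"
      "freq L (K (s k)) \<omega> < u" "1 \<le> L" "1 \<le> M" for k L M \<omega>
    using that unfolding D_def by (intro reg_depth_le_approx_depth) auto
  have upper: "D M L \<omega> \<le> reg_depth P (c k) x + ennreal (q k)"
    if "j < M" "v L j \<omega> \<in> B k" for j k L M \<omega>
    unfolding D_def using that B(4) by (intro approx_depth_le[of j]) auto

  show "AE \<omega> in Q. ((\<lambda>(M, L). D M L \<omega>) \<longlongrightarrow> reg_depth P b0 x) (sequentially \<times>\<^sub>F sequentially)"
    if "common_proposals Q P u d v w" for w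
    using freq_lo freq_hi inside hit that[unfolded common_proposals_def] AE_d_sphere
  proof eventually_elim
    case (elim \<omega>)
    show ?case
    proof (rule tendsto_squeeze_sequences[OF _ _ lo hi])
      fix k
      obtain N where N: "\<And>L. N \<le> L \<Longrightarrow> freq L (K (s k)) \<omega> < u"
        using elim(1) by (auto simp: eventually_sequentially)
      show "eventually (\<lambda>p. reg_depth P (s k) x \<le> (case p of (M, L) \<Rightarrow> D M L \<omega>)) (sequentially \<times>\<^sub>F sequentially)"
        unfolding eventually_prod_sequentially
        by (rule exI[of _ "max 1 N"]) (auto intro!: lower[OF elim(3)] N)
    next
      fix k
      obtain N where N: "\<And>L. N \<le> L \<Longrightarrow> u \<le> freq L (K (b k)) \<omega>"
        using elim(2) by (auto simp: eventually_sequentially)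
      \<comment> \<open>One hit at stage \<open>L0\<close> exhibits a proposal \<open>w i\<close> in
        \<open>B k\<close>. For every \<open>L \<ge> L0\<close> the sample quantile is at most
        \<open>b k\<close>, so this same proposal is accepted.\<close>
      define L0 where "L0 = max 1 N"
      have "1 \<le> L0" "N \<le> L0" by (simp_all add: L0_def)
      then obtain j where j: "v L0 j \<omega> \<in> B k" using elim(4) N by blast
      obtain i where i: "w i \<omega> \<in> B k"
        using elim(5)[rule_format, of L0] j by (auto simp: L0_def)
      have "D M L \<omega> \<le> reg_depth P (c k) x + ennreal (q k)" if "Suc i \<le> M" "L0 \<le> L" for M L
      proof -
        have "1 \<le> L" using that \<open>1 \<le> L0\<close> by linarith
        have "quant L \<omega> \<le> b k"
          using that N[of L] by (intro quant_le b elim(6)) (simp add: L0_def)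
        then have mem: "w i \<omega> \<in> directions P (quant L \<omega>)"
          using i B(3)[of k] by (auto simp: directions_def)
        obtain r where r: "strict_mono r" "range r = {i. w i \<omega> \<in> directions P (quant L \<omega>)}"
            "\<And>m. v L m \<omega> = w (r m) \<omega>"
          using elim(5)[rule_format, OF \<open>1 \<le> L\<close>] by blast
        with mem have "i \<in> range r" by blast
        then obtain m where m: "r m = i" by blast
        \<comment> \<open>Rejection only moves a proposal forward, so \<open>Suc i\<close> accepted
          draws include it for all these \<open>L\<close> simultaneously.\<close>
        have "m \<le> i" using strict_mono_imp_increasing[OF r(1), of m] m by simp
        then show ?thesis using that i r(3)[of m] m by (intro upper[of m]) auto
      qed
      then show "eventually (\<lambda>p. (case p of (M, L) \<Rightarrow> D M L \<omega>) \<le> reg_depth P (c k) x + ennreal (q k))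
          (sequentially \<times>\<^sub>F sequentially)"
        unfolding eventually_prod_sequentially by (intro exI[of _ "max (Suc i) L0"]) auto
    qed
  qed

  show "AE \<omega> in Q. (\<lambda>M. D M (l M) \<omega>) \<longlonglongrightarrow> reg_depth P b0 x"
    if l: "filterlim l sequentially sequentially" for l
  proof -
    \<comment> \<open>\<open>l M\<close> is only eventually positive, while the hitting lemma wants
      positivity for every \<open>M\<close>; \<open>max 1 (l M)\<close> agrees with it
      eventually.\<close>
    have "AE \<omega> in Q. \<forall>k. eventually (\<lambda>M. u \<le> freq (max 1 (l M)) (K (b k)) \<omega> \<longrightarrow>
        (\<exists>j<M. v (max 1 (l M)) j \<omega> \<in> B k)) sequentially"
      unfolding AE_all_countable by (intro allI AE_eventually_hit b B) simp
    with freq_lo freq_hi inside show ?thesis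
    proof eventually_elim
      case (elim \<omega>)
      have l1: "eventually (\<lambda>M. 1 \<le> l M) sequentially"
        using l by (simp add: filterlim_at_top)
      show ?case
      proof (rule tendsto_squeeze_sequences[OF _ _ lo hi])
        fix k
        have "eventually (\<lambda>M. freq (l M) (K (s k)) \<omega> < u) sequentially"
          using eventually_compose_filterlim[OF elim(1)[rule_format] l] .
        with l1 eventually_ge_at_top[of 1]
        show "eventually (\<lambda>M. reg_depth P (s k) x \<le> D M (l M) \<omega>) sequentially"
          by eventually_elim (rule lower[OF elim(3)])
      next
        fix k
        have "eventually (\<lambda>M. u \<le> freq (l M) (K (b k)) \<omega>) sequentially"
          using eventually_compose_filterlim[OF elim(2)[rule_format] l] .
        with l1 elim(4)[rule_format, of k]
        show "eventually (\<lambda>M. D M (l M) \<omega> \<le> reg_depth P (c k) x + ennreal (q k)) sequentially"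
          by eventually_elim (auto simp: max_def intro: upper)
      qed
    qed
  qed

  show "AE \<omega> in Q. \<exists>lim. (\<forall>L\<ge>1. (\<lambda>M. D M L \<omega>) \<longlonglongrightarrow> lim L) \<and> lim \<longlonglongrightarrow> reg_depth P b0 x"
    using freq_lo freq_hi inside hit
  proof eventually_elim
    case (elim \<omega>)
    \<comment> \<open>The depths decrease in \<open>M\<close> only from \<open>M = 1\<close> on,
      since at 0 the minimum is over the empty set; hence the shift. A single hit then bounds the
      infimum from above.\<close>
    define lim where "lim L = (INF M. D (Suc M) L \<omega>)" for L
    have "(\<lambda>M. D M L \<omega>) \<longlonglongrightarrow> lim L" for L
    proof -
      have "decseq (\<lambda>M. D (Suc M) L \<omega>)"
        unfolding D_def approx_depth_def decseq_def by (intro allI impI Min_antimono) auto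
      then have "(\<lambda>M. D (Suc M) L \<omega>) \<longlonglongrightarrow> lim L"
        unfolding lim_def by (rule LIMSEQ_INF)
      then show ?thesis by (rule LIMSEQ_imp_Suc)
    qed
    moreover have "lim \<longlonglongrightarrow> reg_depth P b0 x"
    proof (rule tendsto_squeeze_sequences[OF _ _ lo hi])
      fix k
      show "eventually (\<lambda>L. reg_depth P (s k) x \<le> lim L) sequentially"
        using elim(1)[rule_format, of k] eventually_ge_at_top[of 1]
        by eventually_elim (auto simp: lim_def intro!: INF_greatest lower[OF elim(3)])
    next
      fix k
      show "eventually (\<lambda>L. lim L \<le> reg_depth P (c k) x + ennreal (q k)) sequentially"
        using elim(2)[rule_format, of k] eventually_ge_at_top[of 1]
      proof eventually_elim
        fix L :: nat assume "u \<le> freq L (K (b k)) \<omega>" "1 \<le> L"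
        then obtain j where "v L j \<omega> \<in> B k" using elim(4) by blast
        then have "D (Suc j) L \<omega> \<le> reg_depth P (c k) x + ennreal (q k)"
          by (intro upper[of j]) auto
        then show "lim L \<le> reg_depth P (c k) x + ennreal (q k)"
          unfolding lim_def by (rule INF_lower2[rotated]) simp
      qed
    qed
    ultimately show ?case by blast
  qed
qed

end

section \<open>Transfer from the random direction to its law\<close>

theorem theorem6:
  fixes \<Omega> :: "'a measure"
    and X V :: "'a \<Rightarrow> 'h::{real_inner, banach, polish_space}"
    and P \<nu> :: "'h measure"
    and x :: 'h
    and u \<beta> :: real
    and Q :: "'w measure"
    and d :: "nat \<Rightarrow> 'w \<Rightarrow> 'h"
    and v :: "nat \<Rightarrow> nat \<Rightarrow> 'w \<Rightarrow> 'h"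
    and D :: "nat \<Rightarrow> nat \<Rightarrow> 'w \<Rightarrow> ennreal"
  assumes prob: "prob_space \<Omega>"
    and u: "0 < u" "u < 1"
    and X: "X \<in> borel_measurable \<Omega>" "P = distr \<Omega> borel X"
    and atoms: "(SUP y. measure P {y}) < 1/2"
    and supp: "finite_support P \<or> contiguous_support P"
    and V: "V \<in> borel_measurable \<Omega>" "\<nu> = distr \<Omega> borel V" "\<And>\<omega>. \<omega> \<in> space \<Omega> \<Longrightarrow> V \<omega> \<in> sphere 0 1"
    and indep: "prob_space.indep_var \<Omega> borel X borel V"
    and full: "msupport \<nu> = sphere 0 1"
    and null: "\<And>H. hyperplane H \<Longrightarrow> 0 \<in> H \<Longrightarrow> measure \<nu> (H \<inter> sphere 0 1) = 0"
    and \<beta>: "\<beta> = quantile (cdf (distr \<Omega> borel (\<lambda>\<omega>. proj_MAD P (V \<omega>)))) u"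
    and uniq: "strictly_increasing_at (cdf (distr \<Omega> borel (\<lambda>\<omega>. proj_MAD P (V \<omega>)))) \<beta>"
    and cont: "continuous (at \<beta> within {0..}) (max_outlyingness P x)"
    and sampling: "direction_sampling Q \<nu> P u d v"
    and D: "D = (\<lambda>M L \<omega>. approx_depth P M (\<lambda>m. v L m \<omega>) x)"
  shows
    "(\<forall>w. common_proposals Q P u d v w \<longrightarrow>
        (AE \<omega> in Q. ((\<lambda>(M, L). D M L \<omega>) \<longlongrightarrow> reg_depth P \<beta> x) (sequentially \<times>\<^sub>F sequentially))) \<and>
     (\<forall>l. filterlim l sequentially sequentially \<longrightarrow>
        (AE \<omega> in Q. (\<lambda>M. D M (l M) \<omega>) \<longlonglongrightarrow> reg_depth P \<beta> x)) \<and>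
     (AE \<omega> in Q. \<exists>lim. (\<forall>L\<ge>1. (\<lambda>M. D M L \<omega>) \<longlonglongrightarrow> lim L) \<and> lim \<longlonglongrightarrow> reg_depth P \<beta> x)"
proof -
  interpret \<Omega>: prob_space \<Omega> by (rule prob)
  interpret P: prob_space P unfolding X(2) by (rule \<Omega>.prob_space_distr[OF X(1)])
  interpret nu: prob_space \<nu> unfolding V(2) by (rule \<Omega>.prob_space_distr[OF V(1)])
  interpret Q: prob_space Q using sampling by (simp add: direction_sampling_def)
  have sets_P: "sets P = sets borel" and sets_nu: "sets \<nu> = sets borel" by (simp_all add: X V)
  \<comment> \<open>The orthogonal complement of \<open>w\<close> is a hyperplane through the origin
    with unit normal \<open>w /\<^sub>R norm w\<close>.\<close>
  have nonorthogonal: "AE v in \<nu>. w \<bullet> v \<noteq> 0" if "w \<noteq> 0" for w :: 'h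
  proof -
    define H where "H = {y. y \<bullet> (w /\<^sub>R norm w) = 0}"
    have "hyperplane H"
      unfolding hyperplane_def H_def using that by (intro bexI[of _ "w /\<^sub>R norm w"] exI[of _ 0]) simp_all
    then have "measure \<nu> (H \<inter> sphere 0 1) = 0" by (rule null) (simp add: H_def)
    moreover have "closed H"
      unfolding H_def by (intro closed_Collect_eq continuous_intros)
    then have "H \<inter> sphere 0 1 \<in> sets \<nu>"
      unfolding sets_nu by (intro sets.Int borel_closed closed_unit_sphere)
    ultimately have "H \<inter> sphere 0 1 \<in> null_sets \<nu>"
      by (intro null_setsI) (simp_all add: nu.emeasure_eq_measure)
    then have "AE v in \<nu>. v \<notin> H \<inter> sphere 0 1" by (rule AE_not_in)
    moreover have "AE v in \<nu>. v \<in> sphere 0 1"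
      using AE_in_msupport[OF nu.prob_space_axioms sets_nu] unfolding full .
    ultimately show ?thesis
      by eventually_elim (auto simp: H_def inner_commute)
  qed
  interpret sampled_projections P \<nu> Q u d v
    by unfold_locales (use sets_P sets_nu supp atoms full u sampling nonorthogonal in auto)
  \<comment> \<open>Continuity of \<open>proj_MAD P\<close> is known on the sphere only, so
    measurability passes through the restricted space in which \<open>V\<close> takes its
    values.\<close>
  have MAD_V: "(\<lambda>\<omega>. proj_MAD P (V \<omega>)) \<in> borel_measurable \<Omega>"
  proof (rule measurable_compose[where f=V and g="proj_MAD P"])
    show "V \<in> \<Omega> \<rightarrow>\<^sub>M restrict_space borel (sphere 0 1)"
      using V by (intro measurable_restrict_space2) auto
    show "proj_MAD P \<in> borel_measurable (restrict_space borel (sphere 0 1))"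
      using continuous_on_proj_MAD by (rule borel_measurable_continuous_on_restrict)
  qed
  interpret M: real_distribution "distr \<Omega> borel (\<lambda>\<omega>. proj_MAD P (V \<omega>))"
    using MAD_V by (rule \<Omega>.real_distribution_distr)
  have F: "cdf (distr \<Omega> borel (\<lambda>\<omega>. proj_MAD P (V \<omega>))) t = F t" for t
  proof -
    have "F t = measure \<Omega> (V -` K t \<inter> space \<Omega>)"
      unfolding V(2) by (rule measure_distr[OF V(1) sets_proj_MAD_le])
    also have "V -` K t \<inter> space \<Omega> = (\<lambda>\<omega>. proj_MAD P (V \<omega>)) -` {..t} \<inter> space \<Omega>"
      using V(3) by auto
    finally show ?thesis using MAD_V by (simp add: cdf_def measure_distr)
  qed
  note quantile = M.quantile_cdf[OF u, folded \<beta>, unfolded F]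
  have inc: "F s < F \<beta>" "F \<beta> < F t" if "s < \<beta>" "\<beta> < t" for s t
    using uniq that unfolding strictly_increasing_at_def F by blast+
  \<comment> \<open>At \<open>\<beta> = 0\<close> the distribution function would be at least
    \<open>u > 0\<close>, although the MAD is almost surely positive.\<close>
  have "\<beta> \<noteq> 0"
  proof
    assume "\<beta> = 0"
    have "F 0 \<le> measure \<nu> {}"
      using AE_proj_MAD_pos by (intro nu.finite_measure_mono_AE) (auto elim!: eventually_mono)
    then show False using quantile(3) u \<open>\<beta> = 0\<close> by simp
  qed
  then have pos: "0 < \<beta>" using quantile(1) by simp
  \<comment> \<open>\<open>\<beta> - 1\<close> merely fills the left-hand slot of the two-sided
    condition \<open>strictly_increasing_at\<close>.\<close>
  have above: "u < F t" if "\<beta> < t" for t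
    using inc(2)[of "\<beta> - 1" t] that quantile(3) by simp
  \<comment> \<open>Without a direction of MAD above \<open>\<beta>\<close> the distribution
    function would be constant to the right of \<open>\<beta>\<close>.\<close>
  have beyond: "\<exists>w\<in>sphere 0 1. \<beta> < proj_MAD P w"
  proof (rule ccontr)
    assume "\<not> ?thesis"
    then have "F (\<beta> + 1) = F \<beta>" by (intro arg_cong[where f="measure \<nu>"]) (auto simp: not_less)
    then show False using inc(2)[of "\<beta> - 1" "\<beta> + 1"] by simp
  qed
  show ?thesis
    unfolding D
    using approx_depth_converges[OF pos quantile(2) above beyond cont] by blast
qed

end
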